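(* Let $m\ge 2$, let $\Omega=\{(z,w)\in\mathbb{C}^2:\ 1/4<|z|^2+|w|^m<1\}$, let $P_\delta=(1/2+\delta,0)$ and $\nu=(1,0)$. Then $$F_S^\Omega(P_\delta,\nu)\approx\frac{1}{\delta^{1-\frac1m}}$$ for $\delta>0$ small enough.
   Context: For an open set $\Omega\subset\mathbb{C}^n$, $P\in\Omega$ and $\xi=(\xi_1,\dots,\xi_n)\in\mathbb{C}^n$, the Sibony metric is $F_S^\Omega(P,\xi)=\sup\{(\sum_{i,j=1}^n\frac{\partial^2u(P)}{\partial z_i\partial\bar z_j}\xi_i\bar\xi_j)^{1/2}:\ u\in A_\Omega(P)\}$, where $A_\Omega(P)$ is the set of plurisubharmonic functions $u$ on $\Omega$ such that $u(P)=0$, $u$ is $C^2$ near $P$, $\log u$ is plurisubharmonic on $\Omega$ (with $\log 0=-\infty$), and $0\le u\le 1$ on $\Omega$. For positive functions $a(\delta)$, $b(\delta)$, $a\approx b$ means that there is a constant $C\geq 1$ independent of $\delta$ (it may depend on $m$) with $C^{-1}b(\delta)\le a(\delta)\le C\,b(\delta)$. *)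

theory Defs
  imports "HOL-Analysis.Analysis"
begin

definition usc_on :: "'a::topological_space set \<Rightarrow> ('a \<Rightarrow> ereal) \<Rightarrow> bool" where
  "usc_on S f \<longleftrightarrow> (\<forall>c. openin (top_of_set S) {x \<in> S. f x < c})"

text \<open>
  The Lebesgue integral of an extended real function as the integral of the positive part minus
  the integral of the negative part (\<^const>\<open>e2ennreal\<close> sends negative numbers to 0).  It is
  applied below to upper semicontinuous functions with values in \<open>[-\<infinity>, \<infinity>)\<close> on a circle; these are
  bounded above, so the first integral is finite and the value lies in \<open>[-\<infinity>, \<infinity>)\<close>.
\<close>

definition circle_mean :: "(complex \<Rightarrow> ereal) \<Rightarrow> complex \<Rightarrow> real \<Rightarrow> ereal" where
  "circle_mean f a r = ereal (1 / (2 * pi)) *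
     (enn2ereal (\<integral>\<^sup>+\<theta>\<in>{0..2 * pi}. e2ennreal (f (a + of_real r * cis \<theta>)) \<partial>lborel)
      - enn2ereal (\<integral>\<^sup>+\<theta>\<in>{0..2 * pi}. e2ennreal (- f (a + of_real r * cis \<theta>)) \<partial>lborel))"

text \<open>The function that is identically \<open>-\<infinity>\<close> is admitted, here and for plurisubharmonic functions.\<close>

definition subharmonic_on :: "complex set \<Rightarrow> (complex \<Rightarrow> ereal) \<Rightarrow> bool" where
  "subharmonic_on V f \<longleftrightarrow>
     usc_on V f \<and> (\<forall>x\<in>V. f x < \<infinity>) \<and>
     (\<forall>a r. 0 < r \<and> cball a r \<subseteq> V \<longrightarrow> f a \<le> circle_mean f a r)"

definition plurisubharmonic_on :: "(complex ^ 'n) set \<Rightarrow> (complex ^ 'n \<Rightarrow> ereal) \<Rightarrow> bool" where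
  "plurisubharmonic_on \<Omega> f \<longleftrightarrow>
     usc_on \<Omega> f \<and> (\<forall>x\<in>\<Omega>. f x < \<infinity>) \<and>
     (\<forall>a b. subharmonic_on {t. a + t *s b \<in> \<Omega>} (\<lambda>t. f (a + t *s b)))"

definition log0 :: "real \<Rightarrow> ereal" where
  "log0 t = (if t = 0 then -\<infinity> else ereal (ln t))"

text \<open>Twice continuously differentiable in the real sense, on an open set.\<close>

definition C2_on :: "'a::real_normed_vector set \<Rightarrow> ('a \<Rightarrow> real) \<Rightarrow> bool" where
  "C2_on U u \<longleftrightarrow>
     (\<exists>(D :: 'a \<Rightarrow> 'a \<Rightarrow>\<^sub>L real) (D2 :: 'a \<Rightarrow> 'a \<Rightarrow>\<^sub>L ('a \<Rightarrow>\<^sub>L real)).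
        (\<forall>x\<in>U. (u has_derivative blinfun_apply (D x)) (at x)) \<and>
        (\<forall>x\<in>U. (D has_derivative blinfun_apply (D2 x)) (at x)) \<and>
        continuous_on U D2)"

text \<open>
  The Wirtinger operators \<open>\<partial>/\<partial>z\<^sub>j = (\<partial>/\<partial>x\<^sub>j - \<i> \<partial>/\<partial>y\<^sub>j) / 2\<close> and
  \<open>\<partial>/\<partial>\<bar>z\<^sub>j = (\<partial>/\<partial>x\<^sub>j + \<i> \<partial>/\<partial>y\<^sub>j) / 2\<close>, where \<open>z\<^sub>j = x\<^sub>j + \<i> y\<^sub>j\<close>; the real Frechet derivative in
  the directions \<open>axis j 1\<close> and \<open>axis j \<i>\<close> gives \<open>\<partial>/\<partial>x\<^sub>j\<close> and \<open>\<partial>/\<partial>y\<^sub>j\<close>.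
\<close>

definition dz :: "'n \<Rightarrow> (complex ^ 'n \<Rightarrow> complex) \<Rightarrow> complex ^ 'n \<Rightarrow> complex" where
  "dz j f p = (frechet_derivative f (at p) (axis j 1)
               - \<i> * frechet_derivative f (at p) (axis j \<i>)) / 2"

definition dzbar :: "'n \<Rightarrow> (complex ^ 'n \<Rightarrow> complex) \<Rightarrow> complex ^ 'n \<Rightarrow> complex" where
  "dzbar j f p = (frechet_derivative f (at p) (axis j 1)
                  + \<i> * frechet_derivative f (at p) (axis j \<i>)) / 2"

definition levi_form :: "(complex ^ 'n \<Rightarrow> real) \<Rightarrow> complex ^ 'n \<Rightarrow> complex ^ 'n \<Rightarrow> complex" where
  "levi_form u p \<xi> =
     (\<Sum>i\<in>UNIV. \<Sum>j\<in>UNIV. dz i (dzbar j (\<lambda>z. of_real (u z))) p * \<xi> $ i * cnj (\<xi> $ j))"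

definition sibony_class :: "(complex ^ 'n) set \<Rightarrow> complex ^ 'n \<Rightarrow> (complex ^ 'n \<Rightarrow> real) set" where
  "sibony_class \<Omega> P =
     {u. plurisubharmonic_on \<Omega> (\<lambda>z. ereal (u z)) \<and>
         u P = 0 \<and>
         (\<exists>U. open U \<and> P \<in> U \<and> U \<subseteq> \<Omega> \<and> C2_on U u) \<and>
         plurisubharmonic_on \<Omega> (\<lambda>z. log0 (u z)) \<and>
         (\<forall>z\<in>\<Omega>. 0 \<le> u z \<and> u z \<le> 1)}"

text \<open>
  The Levi form of a real \<open>C\<^sup>2\<close> function is real valued; \<^const>\<open>Re\<close> only adjusts the type.  The
  supremum is taken in the extended reals, so that an unbounded set has supremum \<open>\<infinity>\<close>.
\<close>

definition sibony_metric :: "(complex ^ 'n) set \<Rightarrow> complex ^ 'n \<Rightarrow> complex ^ 'n \<Rightarrow> ereal" where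
  "sibony_metric \<Omega> P \<xi> = (SUP u\<in>sibony_class \<Omega> P. ereal (sqrt (Re (levi_form u P \<xi>))))"

definition shell :: "real \<Rightarrow> (complex ^ 2) set" where
  "shell m = {p. 1/4 < (cmod (p $ 1))\<^sup>2 + cmod (p $ 2) powr m \<and>
                 (cmod (p $ 1))\<^sup>2 + cmod (p $ 2) powr m < 1}"

end

theory Submission
  imports Defs "HOL-Complex_Analysis.Cauchy_Integral_Formula"
begin

text \<open>
  Upper bound: with \<open>R = \<delta> powr (1 - 1/m) / 2\<close> the two discs \<open>t \<mapsto> (1/2 + \<delta> + R t, \<plusminus> t/2)\<close> lie in the
  shell.  Along each of them a competitor \<open>u\<close> satisfies \<open>u \<le> |t|\<^sup>2\<close>, by the Schwarz lemma for
  functions with subharmonic logarithm.  Averaging the two second order bounds at \<open>t = 0\<close> removes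
  the mixed terms and leaves \<open>R\<^sup>2 u\<^bsub>z\<bar>z\<^esub> \<le> 1\<close>.

  Lower bound: put \<open>\<rho> = \<delta> powr (1/m)\<close>.  For \<open>|w| < \<rho>\<close> the slices of the shell stay away from
  \<open>q = 1/2 - 3\<delta>\<close>, so that \<open>|w|\<^sup>2 + \<rho>\<^sup>2 |(z - 1/2 - \<delta>) / (z - q)|\<^sup>2\<close> is bounded there by a multiple of
  \<open>\<rho>\<^sup>2\<close>; it has the required Levi form, of order \<open>\<rho>\<^sup>2 / \<delta>\<^sup>2\<close>.  A small multiple of it is glued, by
  taking the maximum, to \<open>|w| powr (2 + \<epsilon>)\<close>.  The exponent has to exceed 2 in order that the first
  function dominates near the point \<open>(1/2 + \<delta>, 0)\<close>, while \<open>\<epsilon>\<close> is so small, of order \<open>1 / |ln \<rho>|\<close>, that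
  the second one dominates for \<open>|w| > \<rho>/2\<close>.
\<close>

section \<open>Circle means and the maximum principle\<close>

text \<open>A real-valued counterpart of \<open>circle_mean\<close>, built on the gauge integral, so
  that linearity and Cauchy's formula apply without extended arithmetic. The two agree for
  continuous functions, see \<open>circle_mean_real\<close>.\<close>

definition cavg :: "(complex \<Rightarrow> real) \<Rightarrow> complex \<Rightarrow> real \<Rightarrow> real" where
  "cavg k a r = integral {0..2 * pi} (\<lambda>\<theta>. k (a + of_real r * cis \<theta>)) / (2 * pi)"

lemma circle_point_in_sphere: "r \<ge> 0 \<Longrightarrow> a + of_real r * cis \<theta> \<in> sphere a r"
  by (simp add: dist_norm norm_mult)

lemma continuous_on_circle:
  fixes k :: "complex \<Rightarrow> 'a::topological_space"
  assumes "continuous_on (sphere a r) k" "r \<ge> 0"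
  shows "continuous_on S (\<lambda>\<theta>. k (a + of_real r * cis \<theta>))"
  by (rule continuous_on_compose2[OF assms(1)])
     (use circle_point_in_sphere[OF assms(2)] in \<open>auto intro!: continuous_intros\<close>)

lemma circle_integrable:
  assumes "continuous_on (sphere a r) k" "r \<ge> 0"
  shows "(\<lambda>\<theta>. k (a + of_real r * cis \<theta>) :: real) integrable_on {0..2 * pi}"
  by (rule integrable_continuous_interval[OF continuous_on_circle[OF assms]])

lemma cavg_mono:
  assumes "continuous_on (sphere a r) k" "continuous_on (sphere a r) l" "r \<ge> 0"
    and "\<And>t. t \<in> sphere a r \<Longrightarrow> k t \<le> l t"
  shows "cavg k a r \<le> cavg l a r"
  unfolding cavg_def
  by (intro divide_right_mono integral_le circle_integrable assms circle_point_in_sphere) auto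

lemma cavg_add:
  assumes "continuous_on (sphere a r) k" "continuous_on (sphere a r) l" "r \<ge> 0"
  shows "cavg (\<lambda>t. k t + l t) a r = cavg k a r + cavg l a r"
  unfolding cavg_def
  by (subst integral_add) (auto intro!: circle_integrable assms simp: add_divide_distrib)

lemma cavg_cmult: "cavg (\<lambda>t. c * k t) a r = c * cavg k a r"
  by (simp add: cavg_def)

lemma cavg_const [simp]: "cavg (\<lambda>t. c) a r = c"
  by (simp add: cavg_def)

text \<open>This is Cauchy's formula at the centre: in the parametrisation of the circle the
  derivative cancels the denominator \<open>u - a\<close> and leaves the factor
  \<open>\<i>\<close>.\<close>

lemma cavg_holomorphic:
  assumes "f holomorphic_on cball a r" "0 < r"
  shows "cavg (\<lambda>t. Re (f t)) a r = Re (f a)"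
proof -
  have "((\<lambda>u. f u / (u - a)) has_contour_integral (2 * of_real pi * \<i> * f a)) (circlepath a r)"
    using Cauchy_integral_circlepath_simple[OF assms(1), of a] assms(2) by simp
  then have "((\<lambda>t. f (a + r * cis t) / (a + r * cis t - a) * r * \<i> * cis t) has_integral
      (2 * of_real pi * \<i> * f a)) {0..2*pi}"
    unfolding circlepath_def by (subst (asm) has_contour_integral_part_circlepath_iff) auto
  then have "((\<lambda>t. \<i> * f (a + r * cis t)) has_integral (2 * of_real pi * \<i> * f a)) {0..2*pi}"
    by (rule has_integral_eq[rotated]) (use assms(2) in \<open>auto simp: field_simps\<close>)
  then have "((\<lambda>t. (-\<i>) * (\<i> * f (a + r * cis t))) has_integral (-\<i>) * (2 * of_real pi * \<i> * f a)) {0..2*pi}"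
    by (rule has_integral_mult_right)
  then have "((\<lambda>t. f (a + r * cis t)) has_integral (2 * of_real pi * f a)) {0..2*pi}"
    by (simp add: algebra_simps)
  then have "((\<lambda>t. Re (f (a + r * cis t))) has_integral Re (2 * of_real pi * f a)) {0..2*pi}"
    by (rule has_integral_Re)
  then show ?thesis
    by (simp add: cavg_def integral_unique)
qed

text \<open>On the circle the squared distance to \<open>b\<close> coincides with the real part of
  an affine function of \<open>t\<close>, whose mean is its value at \<open>a\<close>. The surplus
  \<open>r\<^sup>2\<close> is what makes the perturbed inequality in
  \<open>maximum_principle\<close> strict.\<close>

lemma cavg_norm_sq:
  assumes "r > 0"
  shows "cavg (\<lambda>t. (cmod (t - b))\<^sup>2) a r = (cmod (a - b))\<^sup>2 + r\<^sup>2"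
proof -
  have "cavg (\<lambda>t. (cmod (t - b))\<^sup>2) a r
      = cavg (\<lambda>t. Re (2 * cnj (a - b) * (t - a) + of_real ((cmod (a - b))\<^sup>2 + r\<^sup>2))) a r"
    unfolding cavg_def
  proof (intro arg_cong[where f="\<lambda>x. x / (2 * pi)"] integral_cong)
    fix \<theta>
    have "cmod (a + of_real r * cis \<theta> - b) ^ 2 = cmod (a - b + of_real r * cis \<theta>) ^ 2"
      by (simp add: algebra_simps)
    also have "\<dots> = (Re (a - b) + r * cos \<theta>)^2 + (Im (a - b) + r * sin \<theta>)^2"
      by (simp add: cmod_power2)
    also have "\<dots> = (Re (a-b))^2 + (Im (a-b))^2 + r^2 * ((cos \<theta>)^2 + (sin \<theta>)^2)
        + 2 * (Re (a-b) * (r * cos \<theta>) + Im (a - b) * (r * sin \<theta>))"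
      by (simp only: power2_eq_square) (simp only: algebra_simps)
    finally show "cmod (a + of_real r * cis \<theta> - b) ^ 2 =
        Re (2 * cnj (a - b) * (a + of_real r * cis \<theta> - a) + of_real ((cmod (a - b))\<^sup>2 + r\<^sup>2))"
      by (simp add: cmod_power2 ring_distribs)
  qed
  also have "\<dots> = Re (2 * cnj (a - b) * (a - a) + of_real ((cmod (a - b))\<^sup>2 + r\<^sup>2))"
    by (rule cavg_holomorphic) (auto intro!: holomorphic_intros assms)
  finally show ?thesis by simp
qed

section \<open>Comparison of the extended and the real circle mean\<close>

lemma circle_mean_mono:
  assumes "\<And>t. t \<in> sphere a r \<Longrightarrow> f t \<le> g t" "r \<ge> 0"
  shows "circle_mean f a r \<le> circle_mean g a r"
  unfolding circle_mean_def
proof (intro ereal_mult_left_mono ereal_minus_mono)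
  have fg: "f (a + of_real r * cis \<theta>) \<le> g (a + of_real r * cis \<theta>)" for \<theta>
    using assms circle_point_in_sphere by blast
  show "enn2ereal (\<integral>\<^sup>+\<theta>\<in>{0..2 * pi}. e2ennreal (f (a + of_real r * cis \<theta>)) \<partial>lborel)
      \<le> enn2ereal (\<integral>\<^sup>+\<theta>\<in>{0..2 * pi}. e2ennreal (g (a + of_real r * cis \<theta>)) \<partial>lborel)"
    unfolding less_eq_ennreal.rep_eq[symmetric]
    by (intro nn_integral_mono mult_right_mono e2ennreal_mono fg) auto
  show "enn2ereal (\<integral>\<^sup>+\<theta>\<in>{0..2 * pi}. e2ennreal (- g (a + of_real r * cis \<theta>)) \<partial>lborel)
      \<le> enn2ereal (\<integral>\<^sup>+\<theta>\<in>{0..2 * pi}. e2ennreal (- f (a + of_real r * cis \<theta>)) \<partial>lborel)"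
    unfolding less_eq_ennreal.rep_eq[symmetric]
    by (intro nn_integral_mono mult_right_mono e2ennreal_mono) (simp_all add: fg)
qed simp

text \<open>Since \<open>e2ennreal\<close> sends negative numbers to 0, the extended integral only
  sees the positive part.\<close>

lemma nn_integral_circle:
  assumes "continuous_on (sphere a r) k" "r \<ge> 0"
  shows "(\<integral>\<^sup>+\<theta>\<in>{0..2 * pi}. e2ennreal (ereal (k (a + of_real r * cis \<theta>))) \<partial>lborel)
    = ennreal (integral {0..2 * pi} (\<lambda>\<theta>. max 0 (k (a + of_real r * cis \<theta>))))"
proof -
  have "continuous_on (sphere a r) (\<lambda>t. max 0 (k t))"
    by (intro continuous_intros assms)
  from circle_integrable[OF this assms(2)]
  have "((\<lambda>\<theta>. max 0 (k (a + of_real r * cis \<theta>))) has_integral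
      integral {0..2 * pi} (\<lambda>\<theta>. max 0 (k (a + of_real r * cis \<theta>)))) {0..2*pi}"
    by (rule integrable_integral)
  from nn_integral_has_integral_lebesgue[OF _ this]
  have "(\<integral>\<^sup>+\<theta>. ennreal (indicator {0..2*pi} \<theta> * max 0 (k (a + of_real r * cis \<theta>))) \<partial>lborel)
    = ennreal (integral {0..2 * pi} (\<lambda>\<theta>. max 0 (k (a + of_real r * cis \<theta>))))"
    by simp
  moreover have "ennreal (indicator {0..2*pi} \<theta> * max 0 x) = e2ennreal (ereal x) * indicator {0..2*pi} \<theta>"
    for \<theta> x :: real
    by (auto simp: indicator_def e2ennreal_ereal max_def ennreal_neg)
  ultimately show ?thesis by simp
qed

lemma circle_mean_real:
  assumes "continuous_on (sphere a r) k" "r \<ge> 0"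
  shows "circle_mean (\<lambda>t. ereal (k t)) a r = ereal (cavg k a r)"
proof -
  let ?I = "\<lambda>k. integral {0..2 * pi} (\<lambda>\<theta>. k (a + of_real r * cis \<theta>) :: real)"
  have cm: "continuous_on (sphere a r) (\<lambda>t. max 0 (k t))" "continuous_on (sphere a r) (\<lambda>t. max 0 (- k t))"
    "continuous_on (sphere a r) (\<lambda>t. - k t)"
    by (intro continuous_intros assms)+
  have "?I (\<lambda>t. max 0 (k t)) - ?I (\<lambda>t. max 0 (- k t)) = ?I (\<lambda>t. max 0 (k t) - max 0 (- k t))"
    by (intro integral_diff[symmetric] circle_integrable[of a r "\<lambda>t. max 0 (k t)"]
          circle_integrable[of a r "\<lambda>t. max 0 (- k t)"] cm assms)
  also have "\<dots> = ?I k"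
    by (intro integral_cong) auto
  finally have eq: "?I (\<lambda>t. max 0 (k t)) - ?I (\<lambda>t. max 0 (- k t)) = ?I k" .
  have nn: "?I (\<lambda>t. max 0 (k t)) \<ge> 0" "?I (\<lambda>t. max 0 (- k t)) \<ge> 0"
    by (intro integral_nonneg circle_integrable[of a r "\<lambda>t. max 0 (k t)"]
          circle_integrable[of a r "\<lambda>t. max 0 (- k t)"] cm assms; simp)+
  have 1: "(\<integral>\<^sup>+\<theta>\<in>{0..2 * pi}. e2ennreal (ereal (k (a + of_real r * cis \<theta>))) \<partial>lborel) = ennreal (?I (\<lambda>t. max 0 (k t)))"
    by (rule nn_integral_circle[OF assms])
  have 2: "(\<integral>\<^sup>+\<theta>\<in>{0..2 * pi}. e2ennreal (- ereal (k (a + of_real r * cis \<theta>))) \<partial>lborel) = ennreal (?I (\<lambda>t. max 0 (- k t)))"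
    using nn_integral_circle[OF cm(3) assms(2)] by simp
  show ?thesis
    unfolding circle_mean_def 1 2 using nn eq
    by (simp add: enn2ereal_ennreal cavg_def)
qed

section \<open>Upper semicontinuous functions and the maximum principle\<close>

text \<open>Without a maximum the sets \<open>{x \<in> K. F x < F y}\<close> cover \<open>K\<close>.
  In a finite subcover the point \<open>d\<close> with the largest threshold would lie in none of
  the sets.\<close>

lemma usc_attains_max:
  fixes F :: "'a::topological_space \<Rightarrow> 'b::linorder"
  assumes "compact K" "K \<noteq> {}" and usc: "\<And>c. openin (top_of_set K) {x \<in> K. F x < c}"
  obtains x where "x \<in> K" "\<And>y. y \<in> K \<Longrightarrow> F y \<le> F x"
proof (rule ccontr)
  assume neg: "\<not> thesis"
  let ?U = "\<lambda>y. {x \<in> K. F x < F y}"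
  have "K \<subseteq> \<Union>(?U ` K)"
    using neg that by (force simp: not_le)
  then obtain D where D: "D \<subseteq> K" "finite D" "K \<subseteq> \<Union>(?U ` D)"
  proof -
    obtain \<D> where "\<D> \<subseteq> ?U ` K" "finite \<D>" "K \<subseteq> \<Union>\<D>"
      using assms(1)[unfolded compact_eq_openin_cover, rule_format, of "?U ` K"] usc \<open>K \<subseteq> \<Union>(?U ` K)\<close>
      by blast
    moreover from this obtain D where "D \<subseteq> K" "finite D" "\<D> = ?U ` D"
      using finite_subset_image[of \<D> ?U K] by blast
    ultimately show ?thesis using that by blast
  qed
  with assms(2) have "D \<noteq> {}" by auto
  have "Max (F ` D) \<in> F ` D" using D \<open>D \<noteq> {}\<close> by simp
  then obtain d where "d \<in> D" "F d = Max (F ` D)" by auto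
  then have "d \<in> K" using D by auto
  then obtain e where "e \<in> D" "F d < F e" using D by auto
  with \<open>F d = _\<close> D show False by (simp add: leD)
qed

text \<open>A sum lies below \<open>c\<close> exactly if some real \<open>s\<close> separates
  \<open>f x\<close> from \<open>c - k x\<close>; this writes the sublevel set as a union of
  intersections of open sets.\<close>

lemma usc_on_add_continuous:
  fixes f :: "'a::topological_space \<Rightarrow> ereal" and k :: "'a \<Rightarrow> real"
  assumes "usc_on K f" "continuous_on K k"
  shows "usc_on K (\<lambda>x. f x + ereal (k x))"
  unfolding usc_on_def
proof
  fix c
  have "{x \<in> K. f x + ereal (k x) < c} =
     (\<Union>s. {x \<in> K. f x < ereal s} \<inter> {x \<in> K. ereal (k x) < c - ereal s})"
  proof (intro equalityI subsetI)
    fix x assume "x \<in> {x \<in> K. f x + ereal (k x) < c}"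
    then have x: "x \<in> K" "f x + ereal (k x) < c" by auto
    then have "f x < c - ereal (k x)" by (simp add: ereal_less_minus_iff)
    then obtain s where s: "f x < ereal s" "ereal s < c - ereal (k x)"
      using ereal_dense2 by blast
    then have "ereal (k x) < c - ereal s"
      by (simp add: ereal_less_minus_iff add.commute)
    with s x show "x \<in> (\<Union>s. {x \<in> K. f x < ereal s} \<inter> {x \<in> K. ereal (k x) < c - ereal s})"
      by blast
  next
    fix x assume "x \<in> (\<Union>s. {x \<in> K. f x < ereal s} \<inter> {x \<in> K. ereal (k x) < c - ereal s})"
    then obtain s where "x \<in> K" "f x < ereal s" "ereal (k x) < c - ereal s" by auto
    moreover from this have "f x + ereal (k x) \<le> ereal s + ereal (k x)"
      by (intro add_right_mono) auto
    moreover have "ereal s + ereal (k x) < c"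
      using calculation by (simp add: ereal_less_minus_iff add.commute)
    ultimately show "x \<in> {x \<in> K. f x + ereal (k x) < c}"
      using le_less_trans by blast
  qed
  moreover have "openin (top_of_set K) {x \<in> K. ereal (k x) < d}" for d
  proof -
    have "continuous_on K (\<lambda>x. ereal (k x))"
      using assms(2) by (rule continuous_on_ereal)
    then have "openin (top_of_set K) (K \<inter> (\<lambda>x. ereal (k x)) -` {..<d})"
      by (rule continuous_openin_preimage_gen) auto
    then show ?thesis by (simp add: vimage_def Int_def)
  qed
  ultimately show "openin (top_of_set K) {x \<in> K. f x + ereal (k x) < c}"
    using assms(1) unfolding usc_on_def by (simp only:) (intro openin_Union, blast)
qed

lemma usc_on_subset: "usc_on S f \<Longrightarrow> T \<subseteq> S \<Longrightarrow> usc_on T f"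
  unfolding usc_on_def
proof
  fix c assume a: "\<forall>c. openin (top_of_set S) {x \<in> S. f x < c}" "T \<subseteq> S"
  then have "openin (top_of_set T) (T \<inter> {x \<in> S. f x < c})"
    by (metis openin_subtopology_Int2 subtopology_subtopology inf.absorb_iff2 inf.commute)
  moreover have "T \<inter> {x \<in> S. f x < c} = {x \<in> T. f x < c}" using a by auto
  ultimately show "openin (top_of_set T) {x \<in> T. f x < c}" by simp
qed

text \<open>The perturbation by \<open>\<epsilon> |t - t\<^sub>0|\<^sup>2\<close> makes the mean value inequality strict, so that no
  measure-theoretic discussion of the equality case is needed.\<close>

lemma maximum_principle:
  fixes f :: "complex \<Rightarrow> ereal" and g :: "complex \<Rightarrow> real"
  assumes "compact K" "open U" "U \<subseteq> K"
    and usc: "usc_on K f" and fin: "\<And>t. t \<in> K \<Longrightarrow> f t < \<infinity>"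
    and g: "continuous_on K g"
    and bd: "\<And>t. t \<in> K - U \<Longrightarrow> f t \<le> ereal (g t)"
    and smv: "\<And>c. c \<in> U \<Longrightarrow> \<exists>s0>0. \<forall>s. 0 < s \<and> s < s0 \<longrightarrow> f c \<le> circle_mean f c s"
    and mvg: "\<And>c. c \<in> U \<Longrightarrow> \<exists>s0>0. \<forall>s. 0 < s \<and> s < s0 \<longrightarrow> cavg g c s \<le> g c"
    and t0: "t0 \<in> K"
  shows "f t0 \<le> ereal (g t0)"
proof (rule ccontr)
  assume neg: "\<not> f t0 \<le> ereal (g t0)"
  then obtain f0 where f0: "f t0 = ereal f0" "f0 > g t0"
    using fin[OF t0] by (cases "f t0") auto
  obtain R where R: "\<And>t. t \<in> K \<Longrightarrow> cmod (t - t0) \<le> R" "R > 0"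
  proof -
    have "bounded ((\<lambda>t. t - t0) ` K)"
      using compact_imp_bounded[OF assms(1)] by (rule bounded_translation_minus)
    then show ?thesis using that unfolding bounded_pos by auto
  qed
  \<comment> \<open>On \<open>K\<close> the perturbation is then at most half of the gap
    \<open>f0 - g t0\<close>, so the maximum of \<open>F\<close> cannot be attained outside
    \<open>U\<close>, where \<open>f \<le> g\<close>.\<close>
  define e where "e = (f0 - g t0) / (2 * R\<^sup>2)"
  have e: "e > 0" using f0 R by (simp add: e_def)
  define F where "F = (\<lambda>t. f t + ereal (e * (cmod (t - t0))\<^sup>2 - g t))"
  have "usc_on K F"
    unfolding F_def by (intro usc_on_add_continuous usc continuous_intros g)
  then obtain c where c: "c \<in> K" and max: "\<And>t. t \<in> K \<Longrightarrow> F t \<le> F c"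
    using usc_attains_max[of K F] assms(1) t0 unfolding usc_on_def by (metis empty_iff)
  have Ft0: "F t0 = ereal (f0 - g t0)" by (simp add: F_def f0)
  have "F c \<ge> ereal (f0 - g t0)" using max[OF t0] Ft0 by simp
  then obtain fc where fc: "f c = ereal fc"
    using fin[OF c] by (cases "f c") (auto simp: F_def)
  have ge: "fc + e * (cmod (c - t0))\<^sup>2 - g c \<ge> f0 - g t0"
    using \<open>F c \<ge> _\<close> by (simp add: F_def fc)
  have "c \<in> U"
  proof (rule ccontr)
    assume "c \<notin> U"
    then have "fc \<le> g c" using bd[of c] c fc by simp
    moreover have "e * (cmod (c - t0))\<^sup>2 \<le> e * R\<^sup>2"
      using R(1)[OF c] e by (intro mult_left_mono power_mono) auto
    moreover have "e * R\<^sup>2 = (f0 - g t0) / 2" using R by (simp add: e_def)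
    ultimately show False using ge f0(2) by argo
  qed
  then obtain s1 where s1: "s1 > 0" "cball c s1 \<subseteq> U"
    using assms(2) open_contains_cball by blast
  obtain s2 where s2: "s2 > 0" "\<And>s. 0 < s \<Longrightarrow> s < s2 \<Longrightarrow> f c \<le> circle_mean f c s"
    using smv[OF \<open>c \<in> U\<close>] by blast
  obtain s3 where s3: "s3 > 0" "\<And>s. 0 < s \<Longrightarrow> s < s3 \<Longrightarrow> cavg g c s \<le> g c"
    using mvg[OF \<open>c \<in> U\<close>] by blast
  define s where "s = min s1 (min s2 s3) / 2"
  have s: "0 < s" "s < s2" "s < s3" "s \<le> s1" using s1 s2 s3 by (auto simp: s_def)
  have sub: "sphere c s \<subseteq> K" using s s1 assms(3) by (force simp: subset_iff)
  \<comment> \<open>\<open>M\<close> is the maximal value of \<open>F\<close>. Solving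
    \<open>F t \<le> M\<close> for \<open>f t\<close> bounds \<open>f\<close> on the circle by a
    continuous function, whose mean is at most \<open>fc - e * s\<^sup>2\<close>.\<close>
  define M where "M = fc + e * (cmod (c - t0))\<^sup>2 - g c"
  have cg: "continuous_on (sphere c s) g" using g sub continuous_on_subset by blast
  have ch: "continuous_on (sphere c s) (\<lambda>t. M + (-e) * (cmod (t - t0))\<^sup>2)"
    by (intro continuous_intros)
  have "f t \<le> ereal (g t + (M + (-e) * (cmod (t - t0))\<^sup>2))" if "t \<in> sphere c s" for t
  proof -
    have "F t \<le> F c" using max sub that by blast
    then show ?thesis
      by (cases "f t") (auto simp: F_def fc M_def)
  qed
  then have "circle_mean f c s \<le> circle_mean (\<lambda>t. ereal (g t + (M + (-e) * (cmod (t - t0))\<^sup>2))) c s"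
    using s by (intro circle_mean_mono) auto
  also have "\<dots> = ereal (cavg (\<lambda>t. g t + (M + (-e) * (cmod (t - t0))\<^sup>2)) c s)"
    using s by (intro circle_mean_real continuous_on_add cg ch) auto
  also have "cavg (\<lambda>t. g t + (M + (-e) * (cmod (t - t0))\<^sup>2)) c s
      = cavg g c s + (M + (-e) * ((cmod (c - t0))\<^sup>2 + s\<^sup>2))"
  proof -
    have "cavg (\<lambda>t. M + (-e) * (cmod (t - t0))\<^sup>2) c s = M + cavg (\<lambda>t. (-e) * (cmod (t - t0))\<^sup>2) c s"
      using s by (subst cavg_add) (auto intro!: continuous_intros)
    then show ?thesis
      using s cavg_add[OF cg ch] unfolding cavg_cmult cavg_norm_sq[OF s(1)] by simp
  qed
  finally have "circle_mean f c s \<le> ereal (cavg g c s + (M + (-e) * ((cmod (c - t0))\<^sup>2 + s\<^sup>2)))" .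
  from order_trans[OF s2(2)[OF s(1,2)] this]
  have "fc \<le> cavg g c s + (M + (-e) * ((cmod (c - t0))\<^sup>2 + s\<^sup>2))"
    by (simp add: fc)
  also have "\<dots> \<le> fc - e * s\<^sup>2"
  proof -
    have "x + (fc + e * A - y + (-e) * (A + B)) \<le> fc - e * B" if "x \<le> y" for x y A B :: real
      using that by (simp add: algebra_simps)
    then show ?thesis using s3(2)[OF s(1,3)] unfolding M_def by blast
  qed
  finally have "e * s\<^sup>2 \<le> 0" by simp
  moreover have "e * s\<^sup>2 > 0" using e s(1) by (intro mult_pos_pos) auto
  ultimately show False by linarith
qed

section \<open>Real polynomials as real parts of holomorphic ones on the unit circle\<close>

text \<open>Because \<open>z * cnj z = 1\<close> on the circle, a common factor \<open>z\<close> of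
  both polynomials cancels. The terms that are left contain \<open>z\<close> only on one side, and
  conjugating them does not change the real part.\<close>

lemma Re_poly_mult_cnj_on_circle:
  "\<exists>r. \<forall>z. cmod z = 1 \<longrightarrow> Re (poly p z * cnj (poly q z)) = Re (poly r z)"
proof (induction p arbitrary: q rule: pCons_induct)
  case 0
  show ?case by (rule exI[of _ 0]) simp
next
  case (pCons a p)
  obtain b q' where q: "q = pCons b q'" by (metis pCons_cases)
  obtain r where r: "\<And>z. cmod z = 1 \<Longrightarrow> Re (poly p z * cnj (poly q' z)) = Re (poly r z)"
    using pCons.IH[of q'] by blast
  show ?case
  proof (intro exI[of _ "[:a * cnj b:] + smult (cnj a) (pCons 0 q') + smult (cnj b) (pCons 0 p) + r"] allI impI)
    fix z assume z: "cmod z = 1"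
    have "z * cnj z = 1" using z by (simp add: complex_norm_square[symmetric])
    have "poly (pCons a p) z * cnj (poly q z)
       = a * cnj b + cnj (cnj a * (z * poly q' z)) + cnj b * (z * poly p z)
         + (z * cnj z) * (poly p z * cnj (poly q' z))"
      by (simp add: q algebra_simps)
    then have "Re (poly (pCons a p) z * cnj (poly q z))
       = Re (a * cnj b) + Re (cnj a * (z * poly q' z)) + Re (cnj b * (z * poly p z)) + Re (poly r z)"
      unfolding \<open>z * cnj z = 1\<close> using r[OF z] by (simp only: plus_complex.sel cnj.sel mult_1_left)
    then show "Re (poly (pCons a p) z * cnj (poly q z)) =
        Re (poly ([:a * cnj b:] + smult (cnj a) (pCons 0 q') + smult (cnj b) (pCons 0 p) + r) z)"
      by (simp only: poly_add poly_smult poly_pCons poly_0 plus_complex.sel) simp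
  qed
qed

text \<open>Turns the polynomials of the Stone-Weierstrass theorem into harmonic functions. Products
  are handled by \<open>Re x * Re y = (Re (x * y) + Re (x * cnj y)) / 2\<close> and the preceding
  lemma.\<close>

lemma real_polynomial_function_on_circle:
  assumes "real_polynomial_function (g :: complex \<Rightarrow> real)"
  shows "\<exists>p. \<forall>z. cmod z = 1 \<longrightarrow> g z = Re (poly p z)"
  using assms
proof induction
  case (linear f)
  interpret bounded_linear f by fact
  \<comment> \<open>The coefficient is \<open>f 1 - \<i> * f \<i>\<close>, which reproduces
    \<open>Re z * f 1 + Im z * f \<i>\<close>.\<close>
  have "f z = Re (poly [:0, Complex (f 1) (- f \<i>):] z)" for z
  proof -
    have "f z = f (Re z *\<^sub>R 1 + Im z *\<^sub>R \<i>)" by (rule arg_cong[of _ _ f]) (simp add: complex_eq_iff)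
    also have "\<dots> = Re z * f 1 + Im z * f \<i>" by (simp only: add scaleR) simp
    finally show ?thesis by simp
  qed
  then show ?case by blast
next
  case (const c)
  show ?case by (rule exI[of _ "[:of_real c:]"]) simp
next
  case (add f g)
  then obtain p q where "\<And>z. cmod z = 1 \<Longrightarrow> f z = Re (poly p z)" "\<And>z. cmod z = 1 \<Longrightarrow> g z = Re (poly q z)"
    by blast
  then show ?case by (intro exI[of _ "p + q"]) simp
next
  case (mult f g)
  then obtain p q where pq: "\<And>z. cmod z = 1 \<Longrightarrow> f z = Re (poly p z)" "\<And>z. cmod z = 1 \<Longrightarrow> g z = Re (poly q z)"
    by blast
  obtain r where r: "\<And>z. cmod z = 1 \<Longrightarrow> Re (poly p z * cnj (poly q z)) = Re (poly r z)"
    using Re_poly_mult_cnj_on_circle by blast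
  have "Re x * Re y = (Re (x * y) + Re (x * cnj y)) / 2" for x y
    by simp
  then have "f z * g z = Re (poly (smult (1/2) (p * q + r)) z)" if "cmod z = 1" for z
    unfolding pq[OF that] using r[OF that] by simp
  then show ?case by blast
qed

lemma usc_on_continuous:
  assumes "continuous_on V u"
  shows "usc_on V (\<lambda>t. ereal (u t))"
  unfolding usc_on_def
proof
  fix c
  have "openin (top_of_set V) (V \<inter> (\<lambda>t. ereal (u t)) -` {..<c})"
    using continuous_on_ereal[OF assms] by (rule continuous_openin_preimage_gen) auto
  then show "openin (top_of_set V) {x \<in> V. ereal (u x) < c}"
    by (simp add: vimage_def Int_def)
qed

text \<open>The boundary values are approximated by real parts of holomorphic polynomials, which avoids
  solving the Dirichlet problem.\<close>

lemma sub_mean_value_local_imp_global: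
  fixes f :: "complex \<Rightarrow> real"
  assumes r: "r > 0" and cf: "continuous_on (cball a r) f"
    and loc: "\<And>c. c \<in> ball a r \<Longrightarrow> \<exists>s0>0. \<forall>s. 0 < s \<and> s < s0 \<longrightarrow> f c \<le> cavg f c s"
  shows "f a \<le> cavg f a r"
proof (rule field_le_epsilon)
  fix e' :: real assume "e' > 0"
  define e where "e = e' / 2"
  have e: "e > 0" using \<open>e' > 0\<close> by (simp add: e_def)
  have cfs: "continuous_on (sphere a r) f"
    using cf by (rule continuous_on_subset) auto
  have "continuous_on (sphere 0 1) (\<lambda>z. f (a + of_real r * z))"
    by (rule continuous_on_compose2[OF cfs]) (use r in \<open>auto intro!: continuous_intros simp: dist_norm norm_mult\<close>)
  then obtain g where "real_polynomial_function g"
    and g: "\<And>z. z \<in> sphere 0 1 \<Longrightarrow> \<bar>f (a + of_real r * z) - g z\<bar> < e"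
    using Stone_Weierstrass_real_polynomial_function[OF compact_sphere _ e] by metis
  then obtain p where p: "\<And>z. cmod z = 1 \<Longrightarrow> g z = Re (poly p z)"
    using real_polynomial_function_on_circle by blast
  \<comment> \<open>Raising the approximant by \<open>e\<close> puts \<open>Re (G t)\<close> above
    \<open>f t\<close> on the sphere, by less than \<open>2 * e = e'\<close>.\<close>
  define G where "G = (\<lambda>t. poly p ((t - a) / of_real r) + of_real e)"
  have G: "G holomorphic_on S" for S
    unfolding G_def using r by (intro holomorphic_intros) auto
  have cG: "continuous_on S (\<lambda>t. Re (G t))" for S
    using G holomorphic_on_imp_continuous_on continuous_on_Re by blast
  have near: "f t \<le> Re (G t)" "Re (G t) \<le> f t + e'" if "t \<in> sphere a r" for t
  proof -
    define z where "z = (t - a) / of_real r"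
    have z: "cmod z = 1" "t = a + of_real r * z"
      using that r by (auto simp: z_def norm_divide dist_norm norm_minus_commute)
    have "\<bar>f t - Re (poly p z)\<bar> < e" using g[of z] p[of z] z by simp
    then show "f t \<le> Re (G t)" "Re (G t) \<le> f t + e'"
      unfolding abs_diff_less_iff by (simp_all add: G_def z_def[symmetric] e_def)
  qed
  \<comment> \<open>The local sub-mean value property of \<open>f\<close> and the exact mean value
    property of the harmonic \<open>Re (G t)\<close> transfer the boundary inequality to the
    centre.\<close>
  have "ereal (f a) \<le> ereal (Re (G a))"
  proof (rule maximum_principle[where K = "cball a r" and U = "ball a r" and f = "\<lambda>t. ereal (f t)"
        and g = "\<lambda>t. Re (G t)" and ?t0.0 = a])
    show "usc_on (cball a r) (\<lambda>t. ereal (f t))"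
      by (rule usc_on_continuous[OF cf])
    show "ereal (f t) \<le> ereal (Re (G t))" if "t \<in> cball a r - ball a r" for t
      using near(1)[of t] that by auto
  next
    fix c assume c: "c \<in> ball a r"
    then obtain s1 where s1: "s1 > 0" "\<And>s. 0 < s \<Longrightarrow> s < s1 \<Longrightarrow> f c \<le> cavg f c s"
      using loc by blast
    obtain s2 where s2: "s2 > 0" "cball c s2 \<subseteq> ball a r"
      using c open_contains_cball by blast
    have "ereal (f c) \<le> circle_mean (\<lambda>t. ereal (f t)) c s" if "0 < s" "s < min s1 s2" for s
    proof -
      have "sphere c s \<subseteq> ball a r" using that s2 by (force simp: subset_iff)
      then have "sphere c s \<subseteq> cball a r" using ball_subset_cball by blast
      then have "circle_mean (\<lambda>t. ereal (f t)) c s = ereal (cavg f c s)"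
        using that by (intro circle_mean_real continuous_on_subset[OF cf]) auto
      then show ?thesis using s1(2)[of s] that by simp
    qed
    then show "\<exists>s0>0. \<forall>s. 0 < s \<and> s < s0 \<longrightarrow> ereal (f c) \<le> circle_mean (\<lambda>t. ereal (f t)) c s"
      using s1 s2 by (intro exI[of _ "min s1 s2"]) auto
    show "\<exists>s0>0. \<forall>s. 0 < s \<and> s < s0 \<longrightarrow> cavg (\<lambda>t. Re (G t)) c s \<le> Re (G c)"
      using cavg_holomorphic[OF G] by (intro exI[of _ 1]) auto
  qed (use r cG in auto)
  then have "f a \<le> Re (G a)" by simp
  also have "\<dots> = cavg (\<lambda>t. Re (G t)) a r"
    using cavg_holomorphic[OF G r] by simp
  also have "\<dots> \<le> cavg (\<lambda>t. f t + e') a r"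
    using r by (intro cavg_mono cG continuous_intros cfs near) auto
  also have "\<dots> = cavg f a r + e'"
    using r by (subst cavg_add) (auto intro!: cfs continuous_intros)
  finally show "f a \<le> cavg f a r + e'" .
qed

section \<open>Functions with subharmonic logarithm\<close>

text \<open>Wherever \<open>u\<close> is positive, its logarithm is touched from below by a harmonic
  function given as \<open>Re (L x)\<close>. The condition is local, needs no derivatives of
  \<open>u\<close>, and passes to maxima.\<close>

definition log_supported_on :: "complex set \<Rightarrow> (complex \<Rightarrow> real) \<Rightarrow> bool" where
  "log_supported_on V u \<longleftrightarrow> (\<forall>c\<in>V. 0 < u c \<longrightarrow>
     (\<exists>S L. open S \<and> c \<in> S \<and> S \<subseteq> V \<and> L holomorphic_on S \<and>
        (\<forall>x\<in>S. exp (Re (L x)) \<le> u x) \<and> exp (Re (L c)) = u c))"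

text \<open>Truncation at \<open>d\<close> keeps the logarithm continuous. Where
  \<open>u c \<le> d\<close> the truncated function is at its minimum \<open>ln d\<close>; elsewhere
  the harmonic minorant touching at \<open>c\<close> gives the inequality on small circles, which
  suffices by \<open>sub_mean_value_local_imp_global\<close>.\<close>

lemma log_supported_sub_mean:
  assumes cu: "continuous_on V u" and supp: "log_supported_on V u"
    and ball: "cball a r \<subseteq> V" and r: "r > 0" and d: "d > 0"
  shows "ln (max (u a) d) \<le> cavg (\<lambda>t. ln (max (u t) d)) a r"
proof (rule sub_mean_value_local_imp_global[OF r])
  let ?k = "\<lambda>t. ln (max (u t) d)"
  have ck: "continuous_on V ?k"
    using d by (intro continuous_intros cu) (auto simp: max_def)
  then show "continuous_on (cball a r) ?k" using ball by (rule continuous_on_subset)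
  fix c assume c: "c \<in> ball a r"
  obtain s1 where s1: "s1 > 0" "cball c s1 \<subseteq> ball a r"
    using c open_contains_cball by blast
  show "\<exists>s0>0. \<forall>s. 0 < s \<and> s < s0 \<longrightarrow> ?k c \<le> cavg ?k c s"
  proof (cases "u c \<le> d")
    case True
    have "?k c \<le> cavg ?k c s" if "0 < s" "s < s1" for s
    proof -
      have "sphere c s \<subseteq> ball a r" using that s1 by (force simp: subset_iff)
      then have "sphere c s \<subseteq> V" using ball ball_subset_cball by blast
      then have "continuous_on (sphere c s) ?k" using ck continuous_on_subset by blast
      then have "cavg (\<lambda>t. ln d) c s \<le> cavg ?k c s"
        using that d by (intro cavg_mono) auto
      then show ?thesis using True d by (simp add: max_absorb2)
    qed
    then show ?thesis using s1 by blast
  next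
    case False
    have "c \<in> V" using c ball by auto
    then obtain S L where S: "open S" "c \<in> S" "S \<subseteq> V" "L holomorphic_on S"
      "\<And>x. x \<in> S \<Longrightarrow> exp (Re (L x)) \<le> u x" "exp (Re (L c)) = u c"
      using supp False d unfolding log_supported_on_def by force
    obtain s2 where s2: "s2 > 0" "cball c s2 \<subseteq> S"
      using S open_contains_cball by blast
    have "?k c \<le> cavg ?k c s" if "0 < s" "s < s2" for s
    proof -
      have sub: "sphere c s \<subseteq> S" "cball c s \<subseteq> S" using that s2 by (force simp: subset_iff)+
      have ck': "continuous_on (sphere c s) ?k" using ck continuous_on_subset sub S by blast
      have hol: "L holomorphic_on cball c s" using S sub holomorphic_on_subset by blast
      have "?k c = Re (L c)" using False S(6)[symmetric] by (simp add: max_absorb1)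
      also have "\<dots> = cavg (\<lambda>t. Re (L t)) c s"
        using cavg_holomorphic[OF hol] that by simp
      also have "\<dots> \<le> cavg ?k c s"
      proof (intro cavg_mono ck')
        show "continuous_on (sphere c s) (\<lambda>t. Re (L t))"
          using hol by (intro continuous_on_Re holomorphic_on_imp_continuous_on)
            (meson holomorphic_on_subset sphere_cball)
        show "Re (L t) \<le> ?k t" if "t \<in> sphere c s" for t
        proof -
          have "exp (Re (L t)) \<le> max (u t) d" using S(5)[of t] that sub by auto
          then show ?thesis using d by (simp add: ln_ge_iff max_def)
        qed
      qed (use that in auto)
      finally show ?thesis .
    qed
    then show ?thesis using s2 by blast
  qed
qed

lemma usc_on_log0:
  assumes "continuous_on V u" "\<And>t. t \<in> V \<Longrightarrow> 0 \<le> u t"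
  shows "usc_on V (\<lambda>t. log0 (u t))"
  unfolding usc_on_def
proof
  fix c
  have "openin (top_of_set V) {x \<in> V. log0 (u x) < c}" if c: "c = ereal y" for y
  proof -
    have "openin (top_of_set V) (V \<inter> u -` {..<exp y})"
      using assms(1) by (rule continuous_openin_preimage_gen) auto
    moreover have "log0 (u x) < c \<longleftrightarrow> u x < exp y" if "x \<in> V" for x
    proof (cases "u x = 0")
      case False
      then have "u x > 0" using assms(2)[OF that] by simp
      then show ?thesis
        using c ln_less_cancel_iff[of "u x" "exp y"] by (simp add: log0_def)
    qed (simp add: log0_def c)
    then have "{x \<in> V. log0 (u x) < c} = V \<inter> u -` {..<exp y}"
      by auto
    ultimately show ?thesis by simp
  qed
  moreover have "{x \<in> V. log0 (u x) < \<infinity>} = V" by (auto simp: log0_def)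
  ultimately show "openin (top_of_set V) {x \<in> V. log0 (u x) < c}"
    by (cases c) auto
qed

text \<open>Jensen's inequality for the exponential, applied to the truncated logarithm; truncation
  changes \<open>u\<close> by at most \<open>d\<close>, which is arbitrary.\<close>

lemma log_supported_subharmonic:
  assumes cu: "continuous_on V u" and supp: "log_supported_on V u"
    and nn: "\<And>t. t \<in> V \<Longrightarrow> 0 \<le> u t"
  shows "subharmonic_on V (\<lambda>t. ereal (u t))"
  unfolding subharmonic_on_def
proof (intro conjI ballI allI impI usc_on_continuous cu)
  fix a r assume "0 < r \<and> cball a r \<subseteq> V"
  then have r: "r > 0" and ball: "cball a r \<subseteq> V" by auto
  have cu': "continuous_on (sphere a r) u"
    using cu ball by (meson continuous_on_subset sphere_cball subset_trans)
  have "u a \<le> cavg u a r"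
  proof (rule field_le_epsilon)
    fix d :: real assume d: "d > 0"
    let ?k = "\<lambda>t. ln (max (u t) d)"
    define y where "y = ?k a"
    have ck: "continuous_on (sphere a r) ?k"
      using d by (intro continuous_intros cu') (auto simp: max_def split: if_splits)
    have pos: "max (u t) d > 0" for t using d by auto
    have y: "exp y = max (u a) d" using d by (simp add: y_def max_def)
    \<comment> \<open>The expression \<open>exp y * (1 - y) + exp y * x\<close> is the tangent of
      \<open>exp\<close> at \<open>y\<close>. It lies below \<open>exp x\<close>, and being affine
      it commutes with the mean.\<close>
    have "exp y = exp y * (1 - y) + exp y * y" by (simp add: algebra_simps)
    also have "\<dots> \<le> exp y * (1 - y) + exp y * cavg ?k a r"
      using log_supported_sub_mean[OF cu supp ball r d]
      by (intro add_left_mono mult_left_mono) (auto simp: y_def)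
    also have "\<dots> = cavg (\<lambda>t. exp y * (1 - y) + exp y * ?k t) a r"
      using r by (subst cavg_add) (auto intro!: continuous_intros ck simp: cavg_cmult)
    also have "\<dots> \<le> cavg (\<lambda>t. u t + d) a r"
    proof (intro cavg_mono continuous_intros ck cu')
      fix t assume "t \<in> sphere a r"
      then have "u t \<ge> 0" using nn ball by (force simp: subset_iff)
      have "exp y * (1 - y) + exp y * ?k t = exp y * (1 + (?k t - y))" by (simp add: algebra_simps)
      also have "\<dots> \<le> exp y * exp (?k t - y)"
        by (intro mult_left_mono exp_ge_add_one_self) auto
      also have "\<dots> = max (u t) d" using d by (simp add: exp_diff max_def)
      also have "\<dots> \<le> u t + d" using d \<open>u t \<ge> 0\<close> by simp
      finally show "exp y * (1 - y) + exp y * ?k t \<le> u t + d" .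
    qed (use r pos in \<open>auto simp: less_imp_neq[symmetric]\<close>)
    also have "\<dots> = cavg u a r + d"
      using r by (subst cavg_add) (auto intro!: continuous_intros cu')
    finally show "u a \<le> cavg u a r + d" unfolding y by simp
  qed
  then show "ereal (u a) \<le> circle_mean (\<lambda>t. ereal (u t)) a r"
    using circle_mean_real[OF cu'] r by simp
qed auto

text \<open>The truncations at \<open>exp (- real n)\<close> satisfy the mean inequality and
  decrease to the logarithm; as \<open>u \<le> 1\<close>, all of them are nonpositive and monotone
  convergence applies to their negatives.\<close>

lemma log_supported_log_subharmonic:
  assumes cu: "continuous_on V u" and supp: "log_supported_on V u"
    and nn: "\<And>t. t \<in> V \<Longrightarrow> 0 \<le> u t" and le1: "\<And>t. t \<in> V \<Longrightarrow> u t \<le> 1"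
  shows "subharmonic_on V (\<lambda>t. log0 (u t))"
  unfolding subharmonic_on_def
proof (intro conjI ballI allI impI usc_on_log0 cu nn)
  fix a r assume "0 < r \<and> cball a r \<subseteq> V"
  then have r: "r > 0" and ball: "cball a r \<subseteq> V" by auto
  have cu': "continuous_on (sphere a r) u"
    using cu ball by (meson continuous_on_subset sphere_cball subset_trans)
  let ?k = "\<lambda>n t. ln (max (u t) (exp (- real n)))"
  let ?c = "\<lambda>\<theta>. a + of_real r * cis \<theta>"
  have cV: "?c \<theta> \<in> V" for \<theta>
    using circle_point_in_sphere[of r a \<theta>] r ball by (auto simp: subset_iff)
  show "log0 (u a) \<le> circle_mean (\<lambda>t. log0 (u t)) a r"
  proof (cases "u a = 0")
    case True then show ?thesis by (simp add: log0_def)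
  next
    case False
    have "a \<in> V" using ball r by auto
    then have ua: "u a > 0" "u a \<le> 1" using False nn le1 by force+
    have kle: "?k n t \<le> 0" "?k n t \<le> ?k 0 t" if "t \<in> V" for n t
      using le1[OF that] by (auto simp: max_def ln_le_zero_iff[OF less_trans[OF exp_gt_zero]] not_le)
    have ck: "continuous_on (sphere a r) (?k n)" for n
      by (intro continuous_intros cu') (auto simp: max_def not_le dest: less_trans[OF exp_gt_zero])
    \<comment> \<open>The bound does not depend on \<open>n\<close>, because truncation only raises
      the value at the centre above \<open>ln (u a)\<close>.\<close>
    have N: "(\<integral>\<^sup>+\<theta>\<in>{0..2 * pi}. e2ennreal (ereal (- ?k n (?c \<theta>))) \<partial>lborel) \<le> ennreal (2 * pi * (- ln (u a)))" for n
    proof -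
      have "(\<integral>\<^sup>+\<theta>\<in>{0..2 * pi}. e2ennreal (ereal (- ?k n (?c \<theta>))) \<partial>lborel)
         = ennreal (integral {0..2 * pi} (\<lambda>\<theta>. max 0 (- ?k n (?c \<theta>))))"
        using r by (intro nn_integral_circle[of a r "\<lambda>t. - ?k n t"] continuous_on_minus ck) auto
      also have "integral {0..2 * pi} (\<lambda>\<theta>. max 0 (- ?k n (?c \<theta>))) = integral {0..2 * pi} (\<lambda>\<theta>. - ?k n (?c \<theta>))"
        using kle(1)[OF cV] by (intro integral_cong) (simp add: max_absorb2 del: max_def)
      also have "\<dots> = 2 * pi * (- cavg (?k n) a r)"
        by (simp add: cavg_def)
      also have "\<dots> \<le> 2 * pi * (- ln (u a))"
      proof -
        have "ln (u a) \<le> ?k n a" using ua by (simp add: max_def)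
        also have "\<dots> \<le> cavg (?k n) a r"
          by (rule log_supported_sub_mean[OF cu supp ball r]) simp
        finally show ?thesis by simp
      qed
      finally show ?thesis by (simp add: ennreal_leI)
    qed
    \<comment> \<open>At a zero of \<open>u\<close> the terms are the integers \<open>n\<close>,
      with supremum \<open>top\<close>; elsewhere the supremum is attained as soon as
      \<open>exp (- real n) \<le> u t\<close>.\<close>
    have sup: "e2ennreal (- log0 (u t)) = (SUP n. e2ennreal (ereal (- ?k n t)))" if "t \<in> V" for t
    proof (cases "u t = 0")
      case True
      have "e2ennreal (ereal (- ?k n t)) = of_nat n" for n
        using True by (simp add: max_def e2ennreal_ereal ennreal_of_nat_eq_real_of_nat)
      then have "(SUP n. e2ennreal (ereal (- ?k n t))) = top"
        using ennreal_SUP_of_nat_eq_top by (simp only:)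
      moreover have "e2ennreal (- log0 (u t)) = top" using True by (simp add: log0_def)
      ultimately show ?thesis by (simp only:)
    next
      case False
      then have ut: "u t > 0" "u t \<le> 1" using nn le1 that by force+
      show ?thesis
      proof (rule antisym)
        obtain n :: nat where n: "- ln (u t) \<le> real n" using real_arch_simple by blast
        then have "exp (- real n) \<le> u t" using ut by (subst ln_ge_iff[symmetric]) auto
        then have "e2ennreal (- log0 (u t)) = e2ennreal (ereal (- ?k n t))"
          using ut by (simp add: log0_def max_absorb1)
        then show "e2ennreal (- log0 (u t)) \<le> (SUP n. e2ennreal (ereal (- ?k n t)))"
          by (auto intro: SUP_upper2)
        have "- ?k n t \<le> - ln (u t)" for n using ut by (simp add: max_def)
        then show "(SUP n. e2ennreal (ereal (- ?k n t))) \<le> e2ennreal (- log0 (u t))"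
          using ut by (intro SUP_least) (auto simp: log0_def intro!: e2ennreal_mono)
      qed
    qed
    have "(\<integral>\<^sup>+\<theta>\<in>{0..2 * pi}. e2ennreal (- log0 (u (?c \<theta>))) \<partial>lborel)
        = (\<integral>\<^sup>+\<theta>. (SUP n. e2ennreal (ereal (- ?k n (?c \<theta>))) * indicator {0..2*pi} \<theta>) \<partial>lborel)"
      using sup[OF cV] by (intro nn_integral_cong) (auto simp: indicator_def)
    also have "\<dots> = (SUP n. (\<integral>\<^sup>+\<theta>\<in>{0..2 * pi}. e2ennreal (ereal (- ?k n (?c \<theta>))) \<partial>lborel))"
    proof (rule nn_integral_monotone_convergence_SUP)
      show "incseq (\<lambda>n \<theta>. e2ennreal (ereal (- ?k n (?c \<theta>))) * indicator {0..2*pi} \<theta>)"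
      proof (intro incseq_SucI le_funI mult_right_mono e2ennreal_mono)
        fix n \<theta>
        have "max (u (?c \<theta>)) (exp (- real (Suc n))) \<le> max (u (?c \<theta>)) (exp (- real n))"
          by (intro max.mono) auto
        then have "?k (Suc n) (?c \<theta>) \<le> ?k n (?c \<theta>)"
          by (subst ln_le_cancel_iff) (simp_all only: less_max_iff_disj exp_gt_zero disj_comms simp_thms)
        then show "ereal (- ?k n (?c \<theta>)) \<le> ereal (- ?k (Suc n) (?c \<theta>))" by simp
      qed simp
      show "(\<lambda>\<theta>. e2ennreal (ereal (- ?k n (?c \<theta>))) * indicator {0..2*pi} \<theta>) \<in> borel_measurable lborel" for n
      proof -
        have "continuous_on UNIV (\<lambda>\<theta>. - ?k n (?c \<theta>))"
          using r by (intro continuous_on_minus continuous_on_circle[of a r "?k n"] ck) auto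
        then have "(\<lambda>\<theta>. - ?k n (?c \<theta>)) \<in> borel_measurable borel"
          by (rule borel_measurable_continuous_onI)
        then show ?thesis by measurable
      qed
    qed
    also have "\<dots> \<le> ennreal (2 * pi * (- ln (u a)))"
      by (intro SUP_least N)
    finally have I: "(\<integral>\<^sup>+\<theta>\<in>{0..2 * pi}. e2ennreal (- log0 (u (?c \<theta>))) \<partial>lborel) \<le> ennreal (2 * pi * (- ln (u a)))" .
    have "e2ennreal (log0 (u (?c \<theta>))) = 0" for \<theta>
      using nn[OF cV[of \<theta>]] le1[OF cV[of \<theta>]] by (auto simp: log0_def e2ennreal_ereal ennreal_neg e2ennreal_neg)
    then have Z: "(\<integral>\<^sup>+\<theta>\<in>{0..2 * pi}. e2ennreal (log0 (u (?c \<theta>))) \<partial>lborel) = 0"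
      by simp
    have "ereal (ln (u a)) = ereal (1 / (2 * pi)) * (0 - enn2ereal (ennreal (2 * pi * (- ln (u a)))))"
      using ua by (simp add: enn2ereal_ennreal mult_nonneg_nonpos)
    also have "\<dots> \<le> circle_mean (\<lambda>t. log0 (u t)) a r"
      unfolding circle_mean_def Z using I
      by (intro ereal_mult_left_mono ereal_minus_mono) (simp_all add: less_eq_ennreal.rep_eq)
    finally show ?thesis using False by (simp add: log0_def)
  qed
qed (auto simp: log0_def)

section \<open>Branches of the logarithm and the Schwarz lemma\<close>

text \<open>Dividing by \<open>F c\<close> moves the value at \<open>c\<close> to 1, so the
  principal branch is holomorphic where the quotient has positive real part; adding
  \<open>ln (cmod (F c))\<close> restores the modulus.\<close>

lemma holomorphic_log_branch:
  assumes "F holomorphic_on S" "open S" "c \<in> S" "F c \<noteq> 0"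
  obtains S' L where "open S'" "c \<in> S'" "S' \<subseteq> S" "L holomorphic_on S'"
    "\<And>x. x \<in> S' \<Longrightarrow> F x \<noteq> 0 \<and> Re (L x) = p * ln (cmod (F x))"
proof -
  define S' where "S' = S \<inter> (\<lambda>x. Re (F x / F c)) -` {0<..}"
  define L where "L = (\<lambda>x. of_real p * (Ln (F x / F c) + of_real (ln (cmod (F c)))))"
  have "continuous_on S (\<lambda>x. Re (F x / F c))"
    using assms by (intro continuous_intros holomorphic_on_imp_continuous_on) auto
  then have "open S'"
    unfolding S'_def using assms(2) by (intro continuous_open_preimage) auto
  moreover have "c \<in> S'" "S' \<subseteq> S" using assms by (auto simp: S'_def)
  moreover have "L holomorphic_on S'"
  proof -
    have "F holomorphic_on S'" using assms(1) \<open>S' \<subseteq> S\<close> holomorphic_on_subset by blast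
    then show ?thesis
      unfolding L_def using assms(4) by (intro holomorphic_intros) (auto simp: S'_def complex_nonpos_Reals_iff)
  qed
  moreover have "F x \<noteq> 0 \<and> Re (L x) = p * ln (cmod (F x))" if "x \<in> S'" for x
  proof -
    have "F x \<noteq> 0" using that by (auto simp: S'_def)
    then have "Re (Ln (F x / F c)) = ln (cmod (F x)) - ln (cmod (F c))"
      using assms(4) by (simp add: norm_divide ln_div)
    then show ?thesis using \<open>F x \<noteq> 0\<close> by (simp add: L_def)
  qed
  ultimately show ?thesis using that by blast
qed

text \<open>The logarithm of \<open>v\<close> is compared with
  \<open>(2 - \<eta>) * ln (cmod t)\<close> on an annulus. The lowered exponent absorbs the constant
  \<open>K\<close> on a sufficiently small inner circle, the bound \<open>v t \<le> 1\<close> serves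
  the outer one, and finally \<open>\<eta>\<close> tends to 0.\<close>

lemma log_subharmonic_schwarz:
  fixes v :: "complex \<Rightarrow> real"
  assumes sh: "subharmonic_on V (\<lambda>t. log0 (v t))" and V: "cball 0 1 \<subseteq> V"
    and v: "\<And>t. t \<in> cball 0 1 \<Longrightarrow> 0 \<le> v t \<and> v t \<le> 1"
    and r0: "r0 > 0" "\<And>t. cmod t < r0 \<Longrightarrow> v t \<le> K * (cmod t)\<^sup>2"
    and t0: "t0 \<in> cball 0 1"
  shows "v t0 \<le> (cmod t0)\<^sup>2"
proof (cases "t0 = 0")
  case True
  then show ?thesis using r0(2)[of 0] r0(1) by simp
next
  case False
  define K' where "K' = max K 1"
  have K': "K' \<ge> 1" "\<And>t. cmod t < r0 \<Longrightarrow> v t \<le> K' * (cmod t)\<^sup>2"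
  proof -
    show "v t \<le> K' * (cmod t)\<^sup>2" if "cmod t < r0" for t
      using r0(2)[OF that] mult_right_mono[of K K' "(cmod t)\<^sup>2"] by (simp add: K'_def)
  qed (simp add: K'_def)
  have bound: "v t0 \<le> cmod t0 powr (2 - \<eta>)" if \<eta>: "0 < \<eta>" "\<eta> < 1" for \<eta>
  proof (cases "v t0 = 0")
    case False
    \<comment> \<open>The last entry yields \<open>K' * r1 powr \<eta> \<le> 1\<close>; halving
      \<open>q\<close> makes the other inequalities strict.\<close>
    define q where "q = min (min r0 (cmod t0)) (min 1 ((1 / K') powr (1 / \<eta>)))"
    define r1 where "r1 = q / 2"
    have q: "0 < q" "q \<le> r0" "q \<le> cmod t0" "q \<le> 1" "q \<le> (1 / K') powr (1 / \<eta>)"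
      using r0(1) \<open>t0 \<noteq> 0\<close> K'(1) unfolding q_def by auto
    then have r1: "0 < r1" "r1 < r0" "r1 < cmod t0" "r1 < 1" "r1 \<le> (1 / K') powr (1 / \<eta>)"
      unfolding r1_def by linarith+
    have "r1 powr \<eta> \<le> ((1 / K') powr (1 / \<eta>)) powr \<eta>"
      using r1 \<eta> by (intro powr_mono2) auto
    also have "\<dots> = 1 / K'" using \<eta> K'(1) by (simp add: powr_powr)
    finally have "K' * r1 powr \<eta> \<le> 1" using K'(1) by (simp add: field_simps)
    then have "K' * r1 powr \<eta> * r1 powr (2 - \<eta>) \<le> 1 * r1 powr (2 - \<eta>)"
      by (intro mult_right_mono) auto
    then have r1': "K' * r1\<^sup>2 \<le> r1 powr (2 - \<eta>)"
      using r1(1) by (simp add: mult.assoc powr_add[symmetric])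
    have "log0 (v t0) \<le> ereal ((2 - \<eta>) * ln (cmod t0))"
    proof (rule maximum_principle[where K = "cball 0 1 - ball 0 r1" and U = "ball 0 1 - cball 0 r1"
          and f = "\<lambda>t. log0 (v t)" and g = "\<lambda>t. (2 - \<eta>) * ln (cmod t)" and ?t0.0 = t0])
      show "compact (cball 0 1 - ball 0 r1 :: complex set)" by (intro compact_diff) auto
      show "open (ball 0 1 - cball 0 r1 :: complex set)" by (intro open_Diff) auto
      show "usc_on (cball 0 1 - ball 0 r1) (\<lambda>t. log0 (v t))"
      proof (rule usc_on_subset)
        show "usc_on V (\<lambda>t. log0 (v t))" using sh unfolding subharmonic_on_def by blast
      qed (use V in blast)
      show "continuous_on (cball 0 1 - ball 0 r1) (\<lambda>t. (2 - \<eta>) * ln (cmod t))"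
        using r1(1) by (intro continuous_intros) auto
      show "t0 \<in> cball 0 1 - ball 0 r1" using t0 r1 by auto
    next
      fix t :: complex assume t: "t \<in> cball 0 1 - ball 0 r1 - (ball 0 1 - cball 0 r1)"
      then consider "cmod t = 1" | "cmod t = r1" by fastforce
      then show "log0 (v t) \<le> ereal ((2 - \<eta>) * ln (cmod t))"
      proof cases
        case 1
        then show ?thesis using v[of t] by (auto simp: log0_def)
      next
        case 2
        then have "v t \<le> r1 powr (2 - \<eta>)" "v t \<ge> 0" using K'(2)[of t] r1 r1' v[of t] t by auto
        then show ?thesis
          using 2 r1(1) by (auto simp: log0_def ln_powr[symmetric] simp del: ln_powr)
      qed
    next
      fix c :: complex assume c: "c \<in> ball 0 1 - cball 0 r1"
      have "open (ball 0 1 - cball 0 r1 :: complex set)" by (intro open_Diff) auto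
      then obtain s1 where s1: "s1 > 0" "cball c s1 \<subseteq> ball 0 1 - cball 0 r1"
        using c open_contains_cball by metis
      have "cball c s \<subseteq> V" if "s < s1" for s
      proof -
        have "cball c s \<subseteq> cball c s1" using that by (intro subset_cball) simp
        also have "\<dots> \<subseteq> cball 0 1" using s1(2) ball_subset_cball by blast
        finally show ?thesis using V by blast
      qed
      then show "\<exists>s0>0. \<forall>s. 0 < s \<and> s < s0 \<longrightarrow> log0 (v c) \<le> circle_mean (\<lambda>t. log0 (v t)) c s"
        using s1(1) sh unfolding subharmonic_on_def by (intro exI[of _ s1]) auto
      have "c \<noteq> 0" using c r1(1) by auto
      then obtain S L where S: "open S" "c \<in> S" "L holomorphic_on S"
        "\<And>x. x \<in> S \<Longrightarrow> Re (L x) = (2 - \<eta>) * ln (cmod x)"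
        using holomorphic_log_branch[of "\<lambda>x. x" UNIV c "2 - \<eta>"]
        by (metis holomorphic_on_ident open_UNIV UNIV_I)
      then obtain s2 where s2: "s2 > 0" "cball c s2 \<subseteq> S"
        using open_contains_cball by metis
      have "cavg (\<lambda>t. (2 - \<eta>) * ln (cmod t)) c s \<le> (2 - \<eta>) * ln (cmod c)" if s: "0 < s" "s < s2" for s
      proof -
        have sub: "cball c s \<subseteq> S" using s s2 by (force simp: subset_iff)
        have "cavg (\<lambda>t. (2 - \<eta>) * ln (cmod t)) c s = cavg (\<lambda>t. Re (L t)) c s"
          unfolding cavg_def using s sub circle_point_in_sphere[of s c]
          by (intro arg_cong[where f = "\<lambda>x. x / (2 * pi)"] integral_cong S(4)[symmetric])
             (meson less_imp_le sphere_cball subsetD)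
        also have "\<dots> = Re (L c)"
          using S(3) sub s by (intro cavg_holomorphic) (auto intro: holomorphic_on_subset)
        finally show ?thesis using S by simp
      qed
      then show "\<exists>s0>0. \<forall>s. 0 < s \<and> s < s0 \<longrightarrow>
          cavg (\<lambda>t. (2 - \<eta>) * ln (cmod t)) c s \<le> (2 - \<eta>) * ln (cmod c)"
        using s2(1) by blast
    qed (auto simp: log0_def)
    then have "ln (v t0) \<le> ln (cmod t0 powr (2 - \<eta>))"
      using False \<open>t0 \<noteq> 0\<close> by (simp add: log0_def)
    then show ?thesis
      using False v[OF t0] \<open>t0 \<noteq> 0\<close> by (subst (asm) ln_le_cancel_iff) auto
  qed simp
  have "((\<lambda>\<eta>. cmod t0 powr (2 - \<eta>)) \<longlongrightarrow> cmod t0 powr (2 - 0)) (at_right 0)"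
    using False by (intro tendsto_intros) auto
  moreover have "eventually (\<lambda>\<eta>. v t0 \<le> cmod t0 powr (2 - \<eta>)) (at_right 0)"
    using bound by (auto simp: eventually_at_right_field intro!: exI[of _ 1])
  ultimately have "v t0 \<le> cmod t0 powr (2 - 0)"
    using tendsto_lowerbound by (metis trivial_limit_at_right_real)
  then show ?thesis using False by simp
qed

section \<open>Second order behaviour at a minimum\<close>

text \<open>If \<open>B h h\<close> exceeded \<open>2 * k\<close>, the directional derivative at
  \<open>P + s *\<^sub>R h\<close> would exceed \<open>2 * k * s\<close> for small
  \<open>s > 0\<close>, and by the mean value theorem \<open>u\<close> would outgrow
  \<open>u P + k * s\<^sup>2\<close>.\<close>

lemma second_derivative_upper:
  fixes u :: "'a::real_normed_vector \<Rightarrow> real"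
  assumes U: "open U" "P \<in> U"
    and D: "\<And>x. x \<in> U \<Longrightarrow> (u has_derivative blinfun_apply (D x)) (at x)"
    and D2: "(D has_derivative blinfun_apply B) (at P)" and DP: "D P = 0"
    and s0: "s0 > 0" "\<And>s. 0 < s \<Longrightarrow> s < s0 \<Longrightarrow> u (P + s *\<^sub>R h) \<le> u P + k * s\<^sup>2"
  shows "B h h \<le> 2 * k"
proof (rule ccontr)
  assume "\<not> B h h \<le> 2 * k"
  then have gt: "B h h > 2 * k" by simp
  have "\<forall>\<^sub>F s in at 0. P + s *\<^sub>R h \<in> U"
  proof (rule topological_tendstoD)
    have "((\<lambda>s. P + s *\<^sub>R h) \<longlongrightarrow> P + 0 *\<^sub>R h) (at 0)" by (intro tendsto_intros)
    then show "((\<lambda>s. P + s *\<^sub>R h) \<longlongrightarrow> P) (at 0)" by simp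
  qed (use U in auto)
  then obtain s1 where s1: "s1 > 0" "\<And>s. s \<noteq> 0 \<Longrightarrow> \<bar>s\<bar> < s1 \<Longrightarrow> P + s *\<^sub>R h \<in> U"
    unfolding eventually_at by (auto simp: dist_real_def)
  have "((\<lambda>s. D (P + s *\<^sub>R h) h) has_derivative (\<lambda>s. B (s *\<^sub>R h) h)) (at 0)"
  proof -
    have "((\<lambda>s. P + s *\<^sub>R h) has_derivative (\<lambda>s. s *\<^sub>R h)) (at 0)"
      by (auto intro!: derivative_eq_intros)
    moreover have "(D has_derivative blinfun_apply B) (at (P + 0 *\<^sub>R h))" using D2 by simp
    ultimately have "((\<lambda>s. D (P + s *\<^sub>R h)) has_derivative (\<lambda>s. B (s *\<^sub>R h))) (at 0)"
      by (rule has_derivative_compose)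
    then show ?thesis by (rule bounded_linear.has_derivative[OF blinfun.bounded_linear_left])
  qed
  then have "((\<lambda>s. D (P + s *\<^sub>R h) h) has_real_derivative B h h) (at 0)"
    by (simp add: has_field_derivative_def blinfun.scaleR_left blinfun.scaleR_right mult_commute_abs)
  then have "((\<lambda>s. D (P + s *\<^sub>R h) h / s) \<longlongrightarrow> B h h) (at 0)"
    by (simp add: has_field_derivative_iff DP)
  from order_tendstoD(1)[OF this gt]
  obtain s2 where s2: "s2 > 0" "\<And>s. s \<noteq> 0 \<Longrightarrow> \<bar>s\<bar> < s2 \<Longrightarrow> 2 * k < D (P + s *\<^sub>R h) h / s"
    unfolding eventually_at by (auto simp: dist_real_def)
  define s where "s = min s0 (min s1 s2) / 2"
  have s: "0 < s" "s < s0" "s < s1" "s < s2" using s0(1) s1(1) s2(1) by (auto simp: s_def)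
  have inU: "P + x *\<^sub>R h \<in> U" if "0 \<le> x" "x \<le> s" for x
    using s1(2)[of x] that s U by (cases "x = 0") auto
  have "((\<lambda>s. u (P + s *\<^sub>R h) - k * s\<^sup>2) has_real_derivative D (P + x *\<^sub>R h) h - 2 * k * x) (at x)"
    if "0 \<le> x" "x \<le> s" for x
  proof -
    have "((\<lambda>s. P + s *\<^sub>R h) has_derivative (\<lambda>s. s *\<^sub>R h)) (at x)"
      by (auto intro!: derivative_eq_intros)
    from has_derivative_compose[OF this D[OF inU[OF that]]]
    have "((\<lambda>s. u (P + s *\<^sub>R h)) has_real_derivative D (P + x *\<^sub>R h) h) (at x)"
      by (simp add: has_field_derivative_def blinfun.scaleR_right mult_commute_abs)
    then show ?thesis by (auto intro!: derivative_eq_intros)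
  qed
  from MVT2[OF s(1) this]
  obtain z where z: "0 < z" "z < s"
    and "u (P + s *\<^sub>R h) - k * s\<^sup>2 - u P = s * (D (P + z *\<^sub>R h) h - 2 * k * z)"
    by auto
  moreover have "D (P + z *\<^sub>R h) h - 2 * k * z > 0"
    using s2(2)[of z] z s by (simp add: field_simps)
  ultimately have "u (P + s *\<^sub>R h) - k * s\<^sup>2 - u P > 0" using s(1) by simp
  then show False using s0(2)[OF s(1,2)] by simp
qed

lemma second_derivative_lower:
  fixes u :: "'a::real_normed_vector \<Rightarrow> real"
  assumes U: "open U" "P \<in> U"
    and D: "\<And>x. x \<in> U \<Longrightarrow> (u has_derivative blinfun_apply (D x)) (at x)"
    and D2: "(D has_derivative blinfun_apply B) (at P)" and DP: "D P = 0"
    and s0: "s0 > 0" "\<And>s. 0 < s \<Longrightarrow> s < s0 \<Longrightarrow> u P + k * s\<^sup>2 \<le> u (P + s *\<^sub>R h)"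
  shows "2 * k \<le> B h h"
proof -
  have "((\<lambda>x. - u x) has_derivative blinfun_apply (- D x)) (at x)" if "x \<in> U" for x
    using has_derivative_minus[OF D[OF that]] by (simp add: uminus_blinfun.rep_eq)
  moreover have "((\<lambda>x. - D x) has_derivative blinfun_apply (- B)) (at P)"
    using has_derivative_minus[OF D2] by (simp add: uminus_blinfun.rep_eq)
  ultimately have "(- B) h h \<le> 2 * (- k)"
    using s0(1) DP by (intro second_derivative_upper[OF U, of "\<lambda>x. - u x" "\<lambda>x. - D x" "- B" s0]) (use s0(2) in force)+
  then show ?thesis by (simp add: blinfun.minus_left)
qed

text \<open>Supplies the bound near 0 that the Schwarz lemma asks for. As \<open>D P = 0\<close>,
  the norm of \<open>D y\<close> is at most linear in the distance to \<open>P\<close>, and the mean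
  value inequality integrates this.\<close>

lemma quadratic_growth:
  fixes u :: "'a::real_normed_vector \<Rightarrow> real"
  assumes U: "open U" "P \<in> U"
    and D: "\<And>x. x \<in> U \<Longrightarrow> (u has_derivative blinfun_apply (D x)) (at x)"
    and D2: "(D has_derivative blinfun_apply B) (at P)" and DP: "D P = 0"
  obtains K r where "r > 0" "K > 0" "\<And>x. norm (x - P) < r \<Longrightarrow> u x \<le> u P + K * (norm (x - P))\<^sup>2"
proof -
  obtain d where d: "d > 0" "\<And>y. norm (y - P) < d \<Longrightarrow> norm (D y - D P - B (y - P)) \<le> 1 * norm (y - P)"
    using D2 unfolding has_derivative_at_alt by (metis zero_less_one)
  obtain r where r: "r > 0" "cball P r \<subseteq> U"
    using U open_contains_cball by blast
  \<comment> \<open>The summand \<open>norm B\<close> bounds the linear part of \<open>D\<close>,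
    the summand 1 its remainder.\<close>
  define K where "K = norm B + 1"
  have K: "norm (D y) \<le> K * norm (y - P)" if "norm (y - P) < d" for y
  proof -
    have "D y = (D y - D P - B (y - P)) + B (y - P)" by (simp add: DP)
    also have "norm \<dots> \<le> 1 * norm (y - P) + norm B * norm (y - P)"
      by (rule norm_triangle_mono[OF d(2)[OF that] norm_blinfun])
    finally show ?thesis by (simp add: K_def algebra_simps)
  qed
  show ?thesis
  proof (rule that[of "min r d" K])
    show "min r d > 0" "K > 0" using r d by (auto simp: K_def add_nonneg_pos)
    fix x assume x: "norm (x - P) < min r d"
    let ?S = "cball P (norm (x - P))"
    have "?S \<subseteq> U" using x r by (auto simp: subset_iff)
    then have "norm (u x - u P) \<le> K * norm (x - P) * norm (x - P)"
    proof (intro differentiable_bound[of ?S u "\<lambda>x. blinfun_apply (D x)"])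
      fix y assume y: "y \<in> ?S"
      then show "(u has_derivative blinfun_apply (D y)) (at y within ?S)"
        using D \<open>?S \<subseteq> U\<close> has_derivative_at_withinI by blast
      have "norm (y - P) \<le> norm (x - P)" using y by (simp add: dist_norm norm_minus_commute)
      then have "norm (D y) \<le> K * norm (y - P)" using x K[of y] by simp
      also have "\<dots> \<le> K * norm (x - P)"
        using \<open>norm (y - P) \<le> norm (x - P)\<close> by (intro mult_left_mono) (auto simp: K_def)
      finally show "onorm (blinfun_apply (D y)) \<le> K * norm (x - P)"
        by (simp add: norm_blinfun.rep_eq)
    qed (auto simp: dist_norm norm_minus_commute)
    then show "u x \<le> u P + K * (norm (x - P))\<^sup>2" by (simp add: power2_eq_square mult.assoc)
  qed
qed

text \<open>This is a quarter of the Laplacian in the first variable; the terms of \<open>B\<close>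
  that mix the directions \<open>1\<close> and \<open>\<i>\<close> are purely imaginary.\<close>

lemma Re_levi_form_axis:
  fixes u :: "complex ^ 2 \<Rightarrow> real"
  assumes U: "open U" "P \<in> U"
    and D: "\<And>x. x \<in> U \<Longrightarrow> (u has_derivative blinfun_apply (D x)) (at x)"
    and D2: "(D has_derivative blinfun_apply B) (at P)"
  shows "Re (levi_form u P (axis 1 1)) =
    (B (axis 1 1) (axis 1 1) + B (axis 1 \<i>) (axis 1 \<i>)) / 4"
proof -
  let ?f = "dzbar 1 (\<lambda>z. complex_of_real (u z))"
  let ?g = "\<lambda>x. (complex_of_real (D x (axis 1 1)) + \<i> * complex_of_real (D x (axis 1 \<i>))) / 2"
  have fg: "?f x = ?g x" if "x \<in> U" for x
  proof -
    have "((\<lambda>z. complex_of_real (u z)) has_derivative (\<lambda>h. complex_of_real (D x h))) (at x)"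
      using D[OF that] by (rule has_derivative_of_real)
    then have "frechet_derivative (\<lambda>z. complex_of_real (u z)) (at x) = (\<lambda>h. complex_of_real (D x h))"
      by (rule frechet_derivative_at[symmetric])
    then show ?thesis by (simp add: dzbar_def)
  qed
  have "(?g has_derivative (\<lambda>h. (complex_of_real (B h (axis 1 1)) + \<i> * complex_of_real (B h (axis 1 \<i>))) / 2)) (at P)"
  proof -
    have "((\<lambda>x. D x e) has_derivative (\<lambda>h. B h e)) (at P)" for e
      using D2 by (rule bounded_linear.has_derivative[OF blinfun.bounded_linear_left])
    note [derivative_intros] = has_derivative_of_real[OF this]
    show ?thesis by (auto intro!: derivative_eq_intros simp: algebra_simps)
  qed
  then have "(?f has_derivative (\<lambda>h. (complex_of_real (B h (axis 1 1)) + \<i> * complex_of_real (B h (axis 1 \<i>))) / 2)) (at P)"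
    by (rule has_derivative_transform_within_open[OF _ U]) (simp add: fg)
  then have "frechet_derivative ?f (at P) =
      (\<lambda>h. (complex_of_real (B h (axis 1 1)) + \<i> * complex_of_real (B h (axis 1 \<i>))) / 2)"
    by (rule frechet_derivative_at[symmetric])
  then show ?thesis
    by (simp add: levi_form_def sum_2 dz_def axis_def)
qed

section \<open>The upper bound\<close>

lemma norm_vector_scalar_mult: "norm (t *s b) = cmod t * norm (b :: complex ^ 'n)"
  by (simp add: norm_vec_def vector_scalar_mult_def norm_mult L2_set_right_distrib)

text \<open>A competitor is nonnegative and vanishes at \<open>P\<close>, so \<open>P\<close> is a
  minimum and the first derivative is zero there.\<close>

lemma sibony_class_second_order:
  assumes "u \<in> sibony_class \<Omega> P"
  obtains U D B where "open U" "P \<in> U" "U \<subseteq> \<Omega>" "D P = 0"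
    "\<And>x. x \<in> U \<Longrightarrow> (u has_derivative blinfun_apply (D x)) (at x)"
    "(D has_derivative blinfun_apply B) (at P)"
proof -
  obtain U D D2 where U: "open U" "P \<in> U" "U \<subseteq> \<Omega>"
    and D: "\<And>x. x \<in> U \<Longrightarrow> (u has_derivative blinfun_apply (D x)) (at x)"
    and D2: "\<And>x. x \<in> U \<Longrightarrow> (D has_derivative blinfun_apply (D2 x)) (at x)"
    using assms unfolding sibony_class_def C2_on_def by blast
  have "\<forall>y\<in>U. u P \<le> u y" using assms U unfolding sibony_class_def by auto
  then have "blinfun_apply (D P) = (\<lambda>v. 0)"
    using differential_zero_maxmin[OF U(2,1) D[OF U(2)]] by blast
  then have "D P = 0" by (intro blinfun_eqI) simp
  then show ?thesis using that U D D2 by blast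
qed

text \<open>The restriction to the disc has a subharmonic logarithm and vanishes quadratically at 0,
  so \<open>log_subharmonic_schwarz\<close> applies.\<close>

lemma sibony_class_disc_bound:
  assumes u: "u \<in> sibony_class \<Omega> P" and disc: "\<And>t. t \<in> cball 0 1 \<Longrightarrow> P + t *s b \<in> \<Omega>"
    and t: "t \<in> cball 0 1"
  shows "u (P + t *s b) \<le> (cmod t)\<^sup>2"
proof -
  obtain U D B where U: "open U" "P \<in> U" "D P = 0"
    and D: "\<And>x. x \<in> U \<Longrightarrow> (u has_derivative blinfun_apply (D x)) (at x)"
    and B: "(D has_derivative blinfun_apply B) (at P)"
    using sibony_class_second_order[OF u] by metis
  obtain K r where K: "r > 0" "K > 0" "\<And>x. norm (x - P) < r \<Longrightarrow> u x \<le> u P + K * (norm (x - P))\<^sup>2"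
    using quadratic_growth[OF U(1,2) D B U(3)] by metis
  show ?thesis
  proof (rule log_subharmonic_schwarz[where v = "\<lambda>t. u (P + t *s b)" and V = "{t. P + t *s b \<in> \<Omega>}"])
    show "subharmonic_on {t. P + t *s b \<in> \<Omega>} (\<lambda>t. log0 (u (P + t *s b)))"
      using u unfolding sibony_class_def plurisubharmonic_on_def by blast
    show "cball 0 1 \<subseteq> {t. P + t *s b \<in> \<Omega>}" using disc by auto
    show "0 \<le> u (P + t *s b) \<and> u (P + t *s b) \<le> 1" if "t \<in> cball 0 1" for t
      using u disc[OF that] unfolding sibony_class_def by auto
    \<comment> \<open>Adding 1 in the denominator includes the case \<open>b = 0\<close>.\<close>
    show "r / (norm b + 1) > 0" using K by (simp add: add_nonneg_pos)
    fix t assume "cmod t < r / (norm b + 1)"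
    then have "cmod t * (norm b + 1) < r" by (simp add: pos_less_divide_eq add_nonneg_pos)
    moreover have "cmod t * norm b \<le> cmod t * (norm b + 1)" by (intro mult_left_mono) auto
    ultimately have "cmod t * norm b < r" by simp
    then have "u (P + t *s b) \<le> u P + K * (cmod t * norm b)\<^sup>2"
      using K(3)[of "P + t *s b"] by (simp add: norm_vector_scalar_mult)
    moreover have "u P = 0" using u unfolding sibony_class_def by auto
    ultimately show "u (P + t *s b) \<le> (K * (norm b)\<^sup>2) * (cmod t)\<^sup>2"
      by (simp add: power_mult_distrib mult.commute mult.left_commute)
  qed (rule t)
qed

text \<open>The parallelogram law cancels the mixed terms of the two discs; since the Hessian is
  nonnegative in the direction of the second variable, only \<open>R\<close> matters.\<close>

lemma sibony_metric_upper:
  fixes P :: "complex ^ 2" and a :: real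
  assumes R: "R > 0"
    and disc: "\<And>t \<sigma>. t \<in> cball 0 1 \<Longrightarrow> \<bar>\<sigma>\<bar> = 1 \<Longrightarrow>
      P + t *s (axis 1 (of_real R) + axis 2 (of_real (\<sigma> * a))) \<in> \<Omega>"
  shows "sibony_metric \<Omega> P (axis 1 1) \<le> ereal (1 / R)"
  unfolding sibony_metric_def
proof (rule SUP_least)
  fix u assume u: "u \<in> sibony_class \<Omega> P"
  obtain U D B where U: "open U" "P \<in> U" "U \<subseteq> \<Omega>" "D P = 0"
    and D: "\<And>x. x \<in> U \<Longrightarrow> (u has_derivative blinfun_apply (D x)) (at x)"
    and B: "(D has_derivative blinfun_apply B) (at P)"
    using sibony_class_second_order[OF u] by metis
  have uP: "u P = 0" and unn: "\<And>x. x \<in> U \<Longrightarrow> u x \<ge> 0"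
    using u U unfolding sibony_class_def by auto
  have nonneg: "0 \<le> B h h" for h
  proof -
    have "((\<lambda>s. P + s *\<^sub>R h) \<longlongrightarrow> P + 0 *\<^sub>R h) (at 0)" by (intro tendsto_intros)
    then have "\<forall>\<^sub>F s in at 0. P + s *\<^sub>R h \<in> U"
      using U by (intro topological_tendstoD) auto
    then obtain s1 where s1: "s1 > 0" "\<And>s. s \<noteq> 0 \<Longrightarrow> \<bar>s\<bar> < s1 \<Longrightarrow> P + s *\<^sub>R h \<in> U"
      unfolding eventually_at by (auto simp: dist_real_def)
    have "2 * 0 \<le> B h h"
      by (rule second_derivative_lower[OF U(1,2) D B U(4) s1(1)]) (use s1(2) unn uP in auto)
    then show ?thesis by simp
  qed
  have Q: "B (axis 1 \<tau>) (axis 1 \<tau>) \<le> 2 / R\<^sup>2" if \<tau>: "cmod \<tau> = 1" for \<tau>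
  proof -
    let ?x = "R *\<^sub>R axis 1 \<tau> :: complex ^ 2" and ?y = "a *\<^sub>R axis 2 \<tau> :: complex ^ 2"
    have le: "B (?x + \<sigma> *\<^sub>R ?y) (?x + \<sigma> *\<^sub>R ?y) \<le> 2 * 1" if \<sigma>: "\<bar>\<sigma>\<bar> = 1" for \<sigma>
    proof (rule second_derivative_upper[OF U(1,2) D B U(4) zero_less_one])
      fix s :: real assume s: "0 < s" "s < 1"
      \<comment> \<open>Rotating the disc parameter turns the real direction with phase
        \<open>\<tau>\<close> into the disc point with parameter \<open>of_real s * \<tau>\<close>;
        the phases 1 and \<open>\<i>\<close> cover both real directions of the first
        variable.\<close>
      have "P + s *\<^sub>R (?x + \<sigma> *\<^sub>R ?y) = P + (of_real s * \<tau>) *s (axis 1 (of_real R) + axis 2 (of_real (\<sigma> * a)))"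
        by (simp add: vec_eq_iff axis_def) (auto simp: complex_eq_iff algebra_simps)
      also have "u \<dots> \<le> (cmod (of_real s * \<tau>))\<^sup>2"
        using s \<tau> by (intro sibony_class_disc_bound[OF u] disc \<sigma>) (auto simp: norm_mult)
      also have "\<dots> = s\<^sup>2" using s \<tau> by (simp add: norm_mult)
      finally show "u (P + s *\<^sub>R (?x + \<sigma> *\<^sub>R ?y)) \<le> u P + 1 * s\<^sup>2" by (simp add: uP)
    qed
    have "B (?x + ?y) (?x + ?y) + B (?x - ?y) (?x - ?y) = 2 * B ?x ?x + 2 * B ?y ?y"
      by (simp only: blinfun.add_left blinfun.add_right blinfun.diff_left blinfun.diff_right)
    then have "B ?x ?x \<le> 2"
      using le[of 1] le[of "-1"] nonneg[of ?y] by simp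
    then show ?thesis
      using R by (simp add: blinfun.scaleR_left blinfun.scaleR_right field_simps power2_eq_square)
  qed
  have "Re (levi_form u P (axis 1 1)) \<le> (1 / R)\<^sup>2"
    using Re_levi_form_axis[OF U(1,2) D B] Q[of 1] Q[of \<i>] by (simp add: power_divide)
  then have "sqrt (Re (levi_form u P (axis 1 1))) \<le> 1 / R"
    using R by (intro real_le_lsqrt) auto
  then show "ereal (sqrt (Re (levi_form u P (axis 1 1)))) \<le> ereal (1 / R)" by simp
qed

text \<open>As long as \<open>R * s < \<delta>\<close>, the first coordinate alone stays outside the
  hole. Otherwise \<open>s / 2 \<ge> \<delta> powr (1 / m)\<close>, hence
  \<open>R * s \<le> (s / 2) powr m\<close>, and the second coordinate compensates what the first
  one loses.\<close>

lemma shell_disc: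
  fixes m \<delta> :: real
  assumes m: "m \<ge> 2" and \<delta>: "0 < \<delta>" "\<delta> < 1 / 16" and R: "R = \<delta> powr (1 - 1 / m) / 2"
    and t: "cmod t \<le> 1" and \<sigma>: "\<bar>\<sigma>\<bar> = 1"
  shows "vector [of_real (1/2 + \<delta>), 0] + t *s (axis 1 (of_real R) + axis 2 (of_real (\<sigma> * (1/2)))) \<in> shell m"
proof -
  define s where "s = cmod t"
  define z where "z = of_real (1/2 + \<delta>) + t * of_real R"
  have s: "0 \<le> s" "s \<le> 1" using t by (auto simp: s_def)
  have R0: "R > 0" using \<delta> by (simp add: R)
  \<comment> \<open>The exponent is at least 1/2 because \<open>m \<ge> 2\<close>, which gives
    \<open>R \<le> 1 / 8\<close> and keeps the disc away from the outer boundary.\<close>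
  have "\<delta> powr (1 - 1 / m) \<le> \<delta> powr (1 / 2)"
    using m \<delta> by (intro powr_mono') (auto simp: field_simps)
  also have "\<dots> \<le> (1 / 16) powr (1 / 2)"
    using \<delta> by (intro powr_mono2) auto
  also have "\<dots> = 1 / 4" by (simp add: powr_half_sqrt real_sqrt_divide)
  finally have R1: "R \<le> 1 / 8" by (simp add: R)
  have cw: "cmod (t * of_real \<sigma>) = s"
    using \<sigma> by (simp add: norm_mult s_def)
  have zle: "cmod z \<le> 1/2 + \<delta> + R * s"
  proof -
    have "cmod z \<le> cmod (of_real (1/2 + \<delta>)) + cmod (t * of_real R)"
      unfolding z_def by (rule norm_triangle_ineq)
    then show ?thesis using \<delta> R0 by (simp add: norm_mult s_def mult.commute del: of_real_add)
  qed
  have zge: "cmod z \<ge> 1/2 + \<delta> - R * s"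
  proof -
    have "cmod z \<ge> cmod (of_real (1/2 + \<delta>)) - cmod (t * of_real R)"
      unfolding z_def using norm_diff_ineq by blast
    then show ?thesis using \<delta> R0 by (simp add: norm_mult s_def mult.commute del: of_real_add)
  qed
  have Rs: "R * s \<le> 1 / 8" using R0 R1 s mult_mono[of R "1/8" s 1] by simp
  have upper: "(cmod z)\<^sup>2 + (s / 2) powr m < 1"
  proof -
    have "(cmod z)\<^sup>2 \<le> (11 / 16)\<^sup>2" using zle Rs \<delta> by (intro power_mono) auto
    moreover have "(s / 2) powr m \<le> (1 / 2) powr m" using s m by (intro powr_mono2) auto
    moreover have "(1 / 2 :: real) powr m \<le> (1 / 2) powr 2" using m by (intro powr_mono') auto
    ultimately show ?thesis by (simp add: power2_eq_square)
  qed
  have lower: "1 / 4 < (cmod z)\<^sup>2 + (s / 2) powr m"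
  proof (cases "R * s < \<delta>")
    case True
    then have "(1 / 2)\<^sup>2 < (cmod z)\<^sup>2" using zge by (intro power_strict_mono) auto
    moreover have "(1 / 2 :: real)\<^sup>2 = 1 / 4" by (simp add: power2_eq_square)
    moreover have "0 \<le> (s / 2) powr m" by simp
    ultimately show ?thesis by linarith
  next
    case False
    then have "\<delta> \<le> R * s" by simp
    then have spos: "s > 0" using \<delta> s by (cases "s = 0") auto
    have "\<delta> / R = 2 * \<delta> powr (1 / m)"
      using \<delta> by (simp add: R powr_diff)
    then have sge: "2 * \<delta> powr (1 / m) \<le> s"
      using \<open>\<delta> \<le> R * s\<close> R0 pos_divide_le_eq[of R \<delta> s] by (simp add: mult.commute)
    have "R * s = (s / 2) * \<delta> powr (1 - 1 / m)" by (simp add: R)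
    also have "\<delta> powr (1 - 1 / m) = (\<delta> powr (1 / m)) powr (m - 1)"
      using m by (simp add: powr_powr field_simps)
    also have "(s / 2) * \<dots> \<le> (s / 2) * (s / 2) powr (m - 1)"
      using sge m s by (intro mult_left_mono powr_mono2) auto
    also have "\<dots> = (s / 2) powr m" using spos by (simp add: powr_diff)
    finally have le: "R * s \<le> (s / 2) powr m" .
    have "(1 / 2 + \<delta> - R * s)\<^sup>2 \<le> (cmod z)\<^sup>2"
      using zge Rs \<delta> by (intro power_mono) auto
    moreover have "(1 / 2 + \<delta> - R * s)\<^sup>2 = 1 / 4 + (\<delta> - R * s) + (\<delta> - R * s)\<^sup>2"
      by (simp add: power2_eq_square algebra_simps)
    ultimately have "1 / 4 + \<delta> - R * s \<le> (cmod z)\<^sup>2"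
      using zero_le_power2[of "\<delta> - R * s"] by linarith
    then show ?thesis using le \<delta> by linarith
  qed
  show ?thesis
    using upper lower unfolding shell_def
    by (simp only: mem_Collect_eq vector_add_component vector_smult_component vector_2 axis_def
        vec_lambda_beta add_0_left add_0_right) (simp add: z_def[symmetric] cw del: of_real_add of_real_mult)
qed

section \<open>The lower bound\<close>

lemma C2_on_cong:
  assumes "C2_on U f" "open U" "\<And>x. x \<in> U \<Longrightarrow> g x = f x"
  shows "C2_on U g"
proof -
  obtain D D2 where D: "\<And>x. x \<in> U \<Longrightarrow> (f has_derivative blinfun_apply (D x)) (at x)"
    "\<And>x. x \<in> U \<Longrightarrow> (D has_derivative blinfun_apply (D2 x)) (at x)" "continuous_on U D2"
    using assms(1) unfolding C2_on_def by blast
  have "(g has_derivative blinfun_apply (D x)) (at x)" if "x \<in> U" for x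
    by (rule has_derivative_transform_within_open[OF D(1)[OF that] assms(2) that]) (simp add: assms(3))
  with D show ?thesis unfolding C2_on_def by blast
qed

lemma C2_on_const: "C2_on U (\<lambda>x. c)"
  unfolding C2_on_def
  by (intro exI[of _ "\<lambda>x. 0"] conjI ballI) (auto simp: zero_blinfun.rep_eq)

lemma C2_on_bounded_linear:
  assumes "bounded_linear f"
  shows "C2_on U f"
  unfolding C2_on_def
proof (intro exI[of _ "\<lambda>x. Blinfun f"] exI[of _ "\<lambda>x. 0"] conjI ballI)
  show "(f has_derivative blinfun_apply (Blinfun f)) (at x)" for x
    using assms by (simp add: bounded_linear_Blinfun_apply bounded_linear_imp_has_derivative)
qed (auto simp: zero_blinfun.rep_eq)

lemma C2_on_add:
  assumes "C2_on U f" "C2_on U g"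
  shows "C2_on U (\<lambda>x. f x + g x)"
proof -
  obtain D D2 where D: "\<And>x. x \<in> U \<Longrightarrow> (f has_derivative blinfun_apply (D x)) (at x)"
    "\<And>x. x \<in> U \<Longrightarrow> (D has_derivative blinfun_apply (D2 x)) (at x)" "continuous_on U D2"
    using assms(1) unfolding C2_on_def by blast
  obtain E E2 where E: "\<And>x. x \<in> U \<Longrightarrow> (g has_derivative blinfun_apply (E x)) (at x)"
    "\<And>x. x \<in> U \<Longrightarrow> (E has_derivative blinfun_apply (E2 x)) (at x)" "continuous_on U E2"
    using assms(2) unfolding C2_on_def by blast
  show ?thesis
    unfolding C2_on_def
    using has_derivative_add[OF D(1) E(1)] has_derivative_add[OF D(2) E(2)] continuous_on_add[OF D(3) E(3)]
    by (intro exI[of _ "\<lambda>x. D x + E x"] exI[of _ "\<lambda>x. D2 x + E2 x"]) (simp add: plus_blinfun.rep_eq)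
qed

lemma C2_on_mult:
  assumes "C2_on U f" "C2_on U g"
  shows "C2_on U (\<lambda>x. f x * g x)"
proof -
  obtain D D2 where D: "\<And>x. x \<in> U \<Longrightarrow> (f has_derivative blinfun_apply (D x)) (at x)"
    "\<And>x. x \<in> U \<Longrightarrow> (D has_derivative blinfun_apply (D2 x)) (at x)" "continuous_on U D2"
    using assms(1) unfolding C2_on_def by blast
  obtain E E2 where E: "\<And>x. x \<in> U \<Longrightarrow> (g has_derivative blinfun_apply (E x)) (at x)"
    "\<And>x. x \<in> U \<Longrightarrow> (E has_derivative blinfun_apply (E2 x)) (at x)" "continuous_on U E2"
    using assms(2) unfolding C2_on_def by blast
  have cont: "continuous_on U f" "continuous_on U g" "continuous_on U D" "continuous_on U E"
    by (rule has_derivative_continuous_on, erule D(1)[THEN has_derivative_at_withinI]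
          D(2)[THEN has_derivative_at_withinI] E(1)[THEN has_derivative_at_withinI]
          E(2)[THEN has_derivative_at_withinI])+
  let ?D = "\<lambda>x. f x *\<^sub>R E x + g x *\<^sub>R D x"
  \<comment> \<open>The two compositions are the rank one maps
    \<open>k \<mapsto> D x k *\<^sub>R E x\<close> and
    \<open>k \<mapsto> E x k *\<^sub>R D x\<close>, from differentiating the scalar factors of
    \<open>?D\<close>.\<close>
  let ?D2 = "\<lambda>x. (f x *\<^sub>R E2 x + (blinfun_scaleR_left (E x) o\<^sub>L D x))
      + (g x *\<^sub>R D2 x + (blinfun_scaleR_left (D x) o\<^sub>L E x))"
  show ?thesis
    unfolding C2_on_def
  proof (intro exI[of _ ?D] exI[of _ ?D2] conjI ballI)
    fix x assume x: "x \<in> U"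
    show "((\<lambda>x. f x * g x) has_derivative blinfun_apply (?D x)) (at x)"
      using has_derivative_mult[OF D(1)[OF x] E(1)[OF x]]
      by (simp add: plus_blinfun.rep_eq scaleR_blinfun.rep_eq mult.commute)
    show "(?D has_derivative blinfun_apply (?D2 x)) (at x)"
      using has_derivative_add[OF has_derivative_scaleR[OF D(1)[OF x] E(2)[OF x]]
          has_derivative_scaleR[OF E(1)[OF x] D(2)[OF x]]]
      by (simp add: plus_blinfun.rep_eq scaleR_blinfun.rep_eq blinfun_compose.rep_eq o_def)
  next
    show "continuous_on U ?D2"
      by (intro continuous_intros cont D E
          bounded_bilinear.continuous_on[OF bounded_bilinear_blinfun_compose]
          bounded_linear.continuous_on[OF bounded_linear_blinfun_scaleR_left])
  qed
qed

lemma C2_on_inverse: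
  assumes "C2_on U f" and nz: "\<And>x. x \<in> U \<Longrightarrow> f x \<noteq> 0"
  shows "C2_on U (\<lambda>x. inverse (f x))"
proof -
  obtain D D2 where D: "\<And>x. x \<in> U \<Longrightarrow> (f has_derivative blinfun_apply (D x)) (at x)"
    "\<And>x. x \<in> U \<Longrightarrow> (D has_derivative blinfun_apply (D2 x)) (at x)" "continuous_on U D2"
    using assms(1) unfolding C2_on_def by blast
  have cont: "continuous_on U f" "continuous_on U D"
    by (rule has_derivative_continuous_on, erule D(1,2)[THEN has_derivative_at_withinI])+
  let ?q = "\<lambda>x. - (inverse (f x) * inverse (f x))"
  let ?D = "\<lambda>x. ?q x *\<^sub>R D x"
  \<comment> \<open>The factor \<open>2 * inverse (f x) ^ 3\<close> comes from differentiating the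
    scalar \<open>?q\<close>.\<close>
  let ?D2 = "\<lambda>x. ?q x *\<^sub>R D2 x + (blinfun_scaleR_left (D x) o\<^sub>L ((2 * inverse (f x) ^ 3) *\<^sub>R D x))"
  show ?thesis
    unfolding C2_on_def
  proof (intro exI[of _ ?D] exI[of _ ?D2] conjI ballI)
    fix x assume x: "x \<in> U"
    have inv: "((\<lambda>x. inverse (f x)) has_derivative (\<lambda>h. ?q x * D x h)) (at x)"
      using Deriv.has_derivative_inverse[OF nz[OF x] D(1)[OF x]] by (simp add: mult.commute mult.left_commute)
    then show "((\<lambda>x. inverse (f x)) has_derivative blinfun_apply (?D x)) (at x)"
      by (simp add: scaleR_blinfun.rep_eq uminus_blinfun.rep_eq)
    have "(?q has_derivative (\<lambda>h. 2 * inverse (f x) ^ 3 * D x h)) (at x)"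
      using has_derivative_minus[OF has_derivative_mult[OF inv inv]]
      by (simp add: power3_eq_cube algebra_simps)
    from has_derivative_scaleR[OF this D(2)[OF x]]
    show "(?D has_derivative blinfun_apply (?D2 x)) (at x)"
      by (simp add: plus_blinfun.rep_eq scaleR_blinfun.rep_eq blinfun_compose.rep_eq o_def uminus_blinfun.rep_eq minus_blinfun.rep_eq)
  next
    show "continuous_on U ?D2"
      using nz
      by (intro continuous_intros cont D
          bounded_bilinear.continuous_on[OF bounded_bilinear_blinfun_compose]
          bounded_linear.continuous_on[OF bounded_linear_blinfun_scaleR_left]) auto
  qed
qed

lemma C2_on_norm_sq_component:
  "C2_on U (\<lambda>x :: complex ^ 'n. (cmod (x $ i - c))\<^sup>2)"
proof -
  have l: "bounded_linear (\<lambda>x :: complex ^ 'n. Re (x $ i))" "bounded_linear (\<lambda>x :: complex ^ 'n. Im (x $ i))"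
    by (intro bounded_linear_compose[OF bounded_linear_Re bounded_linear_vec_nth]
        bounded_linear_compose[OF bounded_linear_Im bounded_linear_vec_nth])+
  have "C2_on U (\<lambda>x :: complex ^ 'n. (Re (x $ i) + - Re c) * (Re (x $ i) + - Re c)
      + (Im (x $ i) + - Im c) * (Im (x $ i) + - Im c))"
    by (intro C2_on_add C2_on_mult C2_on_const C2_on_bounded_linear l)
  then show ?thesis unfolding cmod_power2 by (simp add: power2_eq_square)
qed

section \<open>Plurisubharmonicity from supports on complex lines\<close>

lemma continuous_on_slice: "continuous_on S (\<lambda>t. a + t *s (b :: complex ^ 'n))"
  unfolding vector_scalar_mult_def by (intro continuous_intros)

text \<open>Reduces both plurisubharmonicity conditions of the Sibony class to continuity, the
  range, and harmonic supports on slices.\<close>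

lemma plurisubharmonic_on_log_supported:
  assumes cu: "continuous_on \<Omega> u" and nn: "\<And>x. x \<in> \<Omega> \<Longrightarrow> 0 \<le> u x" and le1: "\<And>x. x \<in> \<Omega> \<Longrightarrow> u x \<le> 1"
    and supp: "\<And>a b. log_supported_on {t. a + t *s b \<in> \<Omega>} (\<lambda>t. u (a + t *s b))"
  shows "plurisubharmonic_on \<Omega> (\<lambda>x. ereal (u x))" "plurisubharmonic_on \<Omega> (\<lambda>x. log0 (u x))"
proof -
  have cs: "continuous_on {t. a + t *s b \<in> \<Omega>} (\<lambda>t. u (a + t *s b))" for a b
    by (rule continuous_on_compose2[OF cu continuous_on_slice]) auto
  show "plurisubharmonic_on \<Omega> (\<lambda>x. ereal (u x))"
    unfolding plurisubharmonic_on_def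
    by (intro conjI ballI allI usc_on_continuous[OF cu] log_supported_subharmonic[OF cs supp])
      (auto intro: nn)
  show "plurisubharmonic_on \<Omega> (\<lambda>x. log0 (u x))"
    unfolding plurisubharmonic_on_def
    by (intro conjI ballI allI usc_on_log0[OF cu] log_supported_log_subharmonic[OF cs supp])
      (auto intro: nn le1 simp: log0_def)
qed

text \<open>Lagrange's identity: the difference of the two sides is the square of
  \<open>cmod (a * y - b * x)\<close>.\<close>

lemma cmod_cnj_combination_sq_le:
  "(cmod (cnj a * x + cnj b * y))\<^sup>2 \<le> ((cmod a)\<^sup>2 + (cmod b)\<^sup>2) * ((cmod x)\<^sup>2 + (cmod y)\<^sup>2)"
proof -
  have "(cmod (cnj a * x + cnj b * y))\<^sup>2 + (cmod (a * y - b * x))\<^sup>2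
      = ((cmod a)\<^sup>2 + (cmod b)\<^sup>2) * ((cmod x)\<^sup>2 + (cmod y)\<^sup>2)"
    unfolding cmod_power2 by (simp add: power2_eq_square algebra_simps)
  then show ?thesis using zero_le_power2[of "cmod (a * y - b * x)"] by linarith
qed

section \<open>The competitor for the lower bound\<close>

lemma open_shell:
  assumes "m \<ge> 2"
  shows "open (shell m)"
proof -
  have "continuous_on UNIV (\<lambda>p :: complex ^ 2. (cmod (p $ 1))\<^sup>2 + cmod (p $ 2) powr m)"
    using assms by (intro continuous_intros continuous_on_powr') auto
  then show ?thesis
    unfolding shell_def by (intro open_Collect_conj open_Collect_less continuous_on_const)
qed

locale competitor =
  fixes m \<delta> :: real
  assumes m: "m \<ge> 2" and \<delta>: "0 < \<delta>" "\<delta> < 1 / 16"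
begin

definition \<rho> :: real where "\<rho> = \<delta> powr (1 / m)"
text \<open>Chosen such that \<open>(\<rho>/2) powr \<epsilon> = 1/4\<close>.  The factor 404 below is \<open>4 (1 + 4 * 25)\<close>, where 25 bounds
  \<open>|h|\<^sup>2\<close> and \<open>\<rho>\<^sup>2 \<le> 4 |w|\<^sup>2\<close> on the overlap of the two regions.\<close>

definition \<epsilon> :: real where "\<epsilon> = ln 4 / ln (2 / \<rho>)"
definition P :: "complex ^ 2" where "P = vector [of_real (1/2 + \<delta>), 0]"
text \<open>A Moebius map vanishing at the first coordinate of \<open>P\<close>. Its pole lies
  \<open>4 * \<delta>\<close> from this zero, which makes its derivative there
  \<open>1 / (4 * \<delta>)\<close>.\<close>

definition h :: "complex \<Rightarrow> complex" where
  "h z = (z - of_real (1/2 + \<delta>)) / (z - of_real (1/2 - 3 * \<delta>))"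
definition inner_part :: "complex ^ 2 \<Rightarrow> real" where
  "inner_part x = ((cmod (x $ 2))\<^sup>2 + \<rho>\<^sup>2 * (cmod (h (x $ 1)))\<^sup>2) / 404"
definition outer :: "complex ^ 2 \<Rightarrow> real" where
  "outer x = cmod (x $ 2) powr (2 + \<epsilon>)"
text \<open>The maximum is confined to \<open>cmod (x $ 2) < \<rho>\<close>, where \<open>h\<close>
  is under control; in the shell, \<open>outer\<close> has already taken over once
  \<open>cmod (x $ 2)\<close> exceeds \<open>\<rho> / 2\<close>.\<close>

definition u :: "complex ^ 2 \<Rightarrow> real" where
  "u x = (if cmod (x $ 2) < \<rho> then max (outer x) (inner_part x) else outer x)"

lemma \<rho>: "0 < \<rho>" "\<rho> < 1" "\<rho> powr m = \<delta>"
proof -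
  show "0 < \<rho>" "\<rho> powr m = \<delta>" using \<delta> m by (simp_all add: \<rho>_def powr_powr)
  have "\<delta> powr (1 / m) < 1 powr (1 / m)" using \<delta> m by (intro powr_less_mono2) auto
  then show "\<rho> < 1" by (simp add: \<rho>_def)
qed

lemma \<epsilon>: "\<epsilon> > 0" "(\<rho> / 2) powr \<epsilon> = 1 / 4"
proof -
  have pos: "ln (2 / \<rho>) > 0" using \<rho> by simp
  then show "\<epsilon> > 0" by (simp add: \<epsilon>_def)
  have "ln (\<rho> / 2) = - ln (2 / \<rho>)" using \<rho> by (simp add: ln_div)
  then have "\<epsilon> * ln (\<rho> / 2) = - ln 4" using pos by (simp add: \<epsilon>_def)
  then show "(\<rho> / 2) powr \<epsilon> = 1 / 4" using \<rho>(1) by (simp add: powr_def exp_minus)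
qed

lemma outer_eq: "outer x = (cmod (x $ 2))\<^sup>2 * cmod (x $ 2) powr \<epsilon>"
  by (cases "x $ 2 = 0") (auto simp: outer_def powr_add)

lemma outer_nonneg: "outer x \<ge> 0"
  by (simp add: outer_def)

text \<open>Here the second coordinate contributes less than \<open>\<delta>\<close> to the defining
  function, so the first has modulus above \<open>1/2 - 2 * \<delta>\<close>, while the pole has
  modulus \<open>1/2 - 3 * \<delta>\<close>.\<close>

lemma pole_dist:
  assumes "x \<in> shell m" "cmod (x $ 2) < \<rho>"
  shows "cmod (x $ 1 - of_real (1/2 - 3 * \<delta>)) > \<delta>"
proof -
  have "cmod (x $ 2) powr m < \<rho> powr m" using assms m by (intro powr_less_mono2) auto
  then have "1 / 4 - \<delta> < (cmod (x $ 1))\<^sup>2" using assms(1) \<rho> by (simp add: shell_def)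
  moreover have "(1 / 2 - 2 * \<delta>)\<^sup>2 \<le> 1 / 4 - \<delta>"
    using \<delta> mult_left_mono[of "4 * \<delta>" 1 \<delta>] by (simp add: power2_eq_square algebra_simps)
  ultimately have "(1 / 2 - 2 * \<delta>)\<^sup>2 < (cmod (x $ 1))\<^sup>2" by linarith
  then have "1 / 2 - 2 * \<delta> < cmod (x $ 1)" by (rule power2_less_imp_less) simp
  moreover have "cmod (x $ 1) - cmod (of_real (1/2 - 3 * \<delta>)) \<le> cmod (x $ 1 - of_real (1/2 - 3 * \<delta>))"
    by (rule norm_triangle_ineq2)
  moreover have "cmod (of_real (1/2 - 3 * \<delta>)) = 1/2 - 3 * \<delta>"
    using \<delta> by (simp only: norm_of_real)
  ultimately show ?thesis by linarith
qed

text \<open>The numerator differs from the denominator by \<open>4 * \<delta>\<close>, and the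
  denominator exceeds \<open>\<delta>\<close> in modulus: hence \<open>1 + 4\<close>.\<close>

lemma h_bound:
  assumes "x \<in> shell m" "cmod (x $ 2) < \<rho>"
  shows "cmod (h (x $ 1)) \<le> 5"
proof -
  let ?n = "cmod (x $ 1 - of_real (1/2 - 3 * \<delta>))"
  have n: "?n > \<delta>" by (rule pole_dist[OF assms])
  have "x $ 1 - of_real (1/2 + \<delta>) = (x $ 1 - of_real (1/2 - 3 * \<delta>)) - of_real (4 * \<delta>)"
    by simp
  then have "cmod (x $ 1 - of_real (1/2 + \<delta>)) \<le> ?n + cmod (of_real (4 * \<delta>))"
    using norm_triangle_ineq4 by metis
  also have "cmod (of_real (4 * \<delta>)) = 4 * \<delta>" using \<delta> by (simp only: norm_of_real)
  finally have "cmod (x $ 1 - of_real (1/2 + \<delta>)) \<le> 5 * ?n" using n by linarith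
  then show ?thesis
    unfolding h_def norm_divide using n \<delta> by (subst pos_divide_le_eq) linarith+
qed

lemma inner_part_bound:
  assumes "x \<in> shell m" "cmod (x $ 2) < \<rho>"
  shows "inner_part x \<le> ((cmod (x $ 2))\<^sup>2 + 25 * \<rho>\<^sup>2) / 404"
proof -
  have "(cmod (h (x $ 1)))\<^sup>2 \<le> 5\<^sup>2" using h_bound[OF assms] by (intro power_mono) auto
  then have "\<rho>\<^sup>2 * (cmod (h (x $ 1)))\<^sup>2 \<le> \<rho>\<^sup>2 * 25" by (intro mult_left_mono) auto
  then show ?thesis by (simp add: inner_part_def)
qed

text \<open>The constants meet in \<open>(1 + 4 * 25) / 404 = 1 / 4\<close>, which is the value of
  \<open>cmod (x $ 2) powr \<epsilon>\<close> at the radius \<open>\<rho> / 2\<close>.\<close>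

lemma inner_part_le_outer:
  assumes "x \<in> shell m" "cmod (x $ 2) < \<rho>" "\<rho> / 2 < cmod (x $ 2)"
  shows "inner_part x \<le> outer x"
proof -
  have "(\<rho> / 2)\<^sup>2 \<le> (cmod (x $ 2))\<^sup>2" using assms \<rho> by (intro power_mono) auto
  then have "\<rho>\<^sup>2 \<le> 4 * (cmod (x $ 2))\<^sup>2" by (simp add: power_divide)
  then have "inner_part x \<le> (cmod (x $ 2))\<^sup>2 * (1 / 4)"
    using inner_part_bound[OF assms(1,2)] by simp
  also have "\<dots> \<le> outer x"
    unfolding outer_eq \<epsilon>(2)[symmetric] using assms \<rho> \<epsilon>
    by (intro mult_left_mono powr_mono2) auto
  finally show ?thesis .
qed

lemma u_eq_outer: "x \<in> shell m \<Longrightarrow> \<rho> / 2 < cmod (x $ 2) \<Longrightarrow> u x = outer x"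
  using inner_part_le_outer by (auto simp: u_def max_def intro: antisym)

lemma outer_le_u: "outer x \<le> u x"
  by (simp add: u_def)

lemma u_range:
  assumes "x \<in> shell m"
  shows "0 \<le> u x" "u x \<le> 1"
proof -
  show "0 \<le> u x" using outer_le_u outer_nonneg order_trans by blast
  have "cmod (x $ 2) powr m < 1"
    using assms zero_le_power2[of "cmod (x $ 1)"] unfolding shell_def by (simp, linarith)
  then have w: "cmod (x $ 2) \<le> 1"
    using m powr_mono2[of m 1 "cmod (x $ 2)"] by (cases "cmod (x $ 2) \<le> 1") auto
  have "outer x \<le> 1"
    unfolding outer_def using w \<epsilon> powr_mono2[of "2 + \<epsilon>" "cmod (x $ 2)" 1] by simp
  moreover have "inner_part x \<le> 1" if "cmod (x $ 2) < \<rho>"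
  proof -
    have "(cmod (x $ 2))\<^sup>2 \<le> 1" "\<rho>\<^sup>2 \<le> 1" using w \<rho> by (auto intro: power_le_one)
    then show ?thesis using inner_part_bound[OF assms that] by simp
  qed
  ultimately show "u x \<le> 1" by (simp add: u_def)
qed

text \<open>The open sets \<open>cmod (x $ 2) < \<rho>\<close> and
  \<open>cmod (x $ 2) > \<rho> / 2\<close> cover the shell, and on each of them \<open>u\<close> is
  given by one continuous formula.\<close>

lemma continuous_on_u: "continuous_on (shell m) u"
proof -
  let ?A = "shell m \<inter> {x. cmod (x $ 2) < \<rho>}" and ?B = "shell m \<inter> {x. \<rho> / 2 < cmod (x $ 2)}"
  have op: "open ?A" "open ?B"
    by (intro open_Int open_shell m open_Collect_less continuous_intros)+
  have co: "continuous_on S outer" for S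
    unfolding outer_def using \<epsilon>(1) by (intro continuous_intros continuous_on_powr') auto
  have ci: "continuous_on ?A inner_part"
    unfolding inner_part_def h_def using pole_dist \<delta> by (intro continuous_intros) fastforce+
  have "continuous_on ?A u"
  proof (rule continuous_on_eq)
    show "continuous_on ?A (\<lambda>x. max (outer x) (inner_part x))"
      by (intro continuous_on_max co ci)
  qed (auto simp: u_def)
  moreover have "continuous_on ?B u"
    by (rule continuous_on_eq[OF co]) (auto simp: u_eq_outer)
  ultimately have "continuous_on (?A \<union> ?B) u"
    using op by (intro continuous_on_open_Un)
  moreover have "?A \<union> ?B = shell m" using \<rho> by (auto simp: not_less)
  ultimately show ?thesis by simp
qed

text \<open>It suffices to support whichever of \<open>outer\<close> and \<open>inner_part\<close>
  realises \<open>u\<close> at the given point, as \<open>u\<close> dominates both nearby.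
  \<open>outer\<close> is locally the exponential of a harmonic function, and
  \<open>inner_part\<close> is a sum of squared moduli of holomorphic functions.\<close>

lemma log_supported_u: "log_supported_on {t. a + t *s b \<in> shell m} (\<lambda>t. u (a + t *s b))"
  unfolding log_supported_on_def
proof (intro ballI impI)
  let ?V = "{t. a + t *s b \<in> shell m}"
  let ?x = "\<lambda>t. a + t *s b" and ?w = "\<lambda>t. a $ 2 + t * b $ 2"
  fix c assume c: "c \<in> ?V" and pos: "0 < u (?x c)"
  have opV: "open ?V"
    using open_vimage[OF open_shell[OF m] continuous_on_slice] by (simp add: vimage_def)
  show "\<exists>S L. open S \<and> c \<in> S \<and> S \<subseteq> ?V \<and> L holomorphic_on S \<and>
      (\<forall>t\<in>S. exp (Re (L t)) \<le> u (?x t)) \<and> exp (Re (L c)) = u (?x c)"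
  proof (cases "u (?x c) = outer (?x c)")
    case True
    then have "?w c \<noteq> 0" using pos by (auto simp: outer_def)
    moreover have "?w holomorphic_on ?V" by (intro holomorphic_intros)
    ultimately obtain S L where S: "open S" "c \<in> S" "S \<subseteq> ?V" "L holomorphic_on S"
      "\<And>t. t \<in> S \<Longrightarrow> ?w t \<noteq> 0 \<and> Re (L t) = (2 + \<epsilon>) * ln (cmod (?w t))"
      using holomorphic_log_branch[of ?w ?V c "2 + \<epsilon>"] opV c by metis
    have "exp (Re (L t)) = outer (?x t)" if "t \<in> S" for t
      using S(5)[OF that] by (simp add: outer_def powr_def)
    then show ?thesis using S True outer_le_u by metis
  next
    case False
    then have wc: "cmod (?w c) < \<rho>" and uc: "u (?x c) = inner_part (?x c)"
      by (auto simp: u_def max_def split: if_splits)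
    let ?k = "\<lambda>t. of_real \<rho> * h (a $ 1 + t * b $ 1)"
    let ?V' = "?V \<inter> {t. cmod (?w t) < \<rho>}"
    have op: "open ?V'"
      by (intro open_Int opV open_Collect_less continuous_intros)
    define N where "N = (cmod (?w c))\<^sup>2 + (cmod (?k c))\<^sup>2"
    have inner_part: "inner_part (?x t) = ((cmod (?w t))\<^sup>2 + (cmod (?k t))\<^sup>2) / 404" for t
      by (simp add: inner_part_def norm_mult power_mult_distrib)
    have N: "N > 0" "inner_part (?x c) = N / 404" using pos uc inner_part[of c] by (auto simp: N_def)
    txt \<open>By Cauchy--Schwarz, this holomorphic combination of \<open>w\<close> and \<open>\<rho> h\<close> is dominated by \<open>inner_part\<close>,
      with equality at \<open>c\<close>.\<close>
    define F where "F = (\<lambda>t. (cnj (?w c) * ?w t + cnj (?k c) * ?k t) / of_real (sqrt (404 * N)))"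
    have F: "F holomorphic_on ?V'"
    proof -
      have "a $ 1 + t * b $ 1 - of_real (1/2 - 3 * \<delta>) \<noteq> 0" if "t \<in> ?V'" for t
        using pole_dist[of "?x t"] that \<delta> by auto
      then show ?thesis
        unfolding F_def h_def using N by (intro holomorphic_intros) auto
    qed
    have Fle: "(cmod (F t))\<^sup>2 \<le> inner_part (?x t)" for t
    proof -
      have "(cmod (F t))\<^sup>2 = (cmod (cnj (?w c) * ?w t + cnj (?k c) * ?k t))\<^sup>2 / (404 * N)"
        using N by (simp add: F_def norm_divide power_divide del: of_real_mult)
      also have "\<dots> \<le> (N * ((cmod (?w t))\<^sup>2 + (cmod (?k t))\<^sup>2)) / (404 * N)"
        unfolding N_def by (intro divide_right_mono cmod_cnj_combination_sq_le) auto
      also have "\<dots> = inner_part (?x t)" using N by (simp add: inner_part)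
      finally show ?thesis .
    qed
    have Fc: "(cmod (F c))\<^sup>2 = inner_part (?x c)"
    proof -
      have "cnj (?w c) * ?w c + cnj (?k c) * ?k c = of_real N"
        unfolding N_def of_real_add complex_norm_square by (simp only: mult.commute)
      then have "(cmod (F c))\<^sup>2 = N\<^sup>2 / (404 * N)"
        unfolding F_def norm_divide norm_of_real power_divide using N by simp
      then show ?thesis using N by (simp add: power2_eq_square)
    qed
    then have "F c \<noteq> 0" using N by auto
    moreover have "c \<in> ?V'" using c wc by auto
    ultimately obtain S L where S: "open S" "c \<in> S" "S \<subseteq> ?V'" "L holomorphic_on S"
      "\<And>t. t \<in> S \<Longrightarrow> F t \<noteq> 0 \<and> Re (L t) = 2 * ln (cmod (F t))"
      using holomorphic_log_branch[OF F op, of c 2] by metis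
    have eq: "exp (Re (L t)) = (cmod (F t))\<^sup>2" if "t \<in> S" for t
      using S(5)[OF that] by (simp add: exp_double)
    have "inner_part (?x t) \<le> u (?x t)" if "t \<in> S" for t
      using that S(3) by (auto simp: u_def)
    then have "\<forall>t\<in>S. exp (Re (L t)) \<le> u (?x t)"
      using eq Fle by (metis order_trans)
    moreover have "exp (Re (L c)) = u (?x c)" using eq[OF S(2)] Fc uc by simp
    ultimately show ?thesis using S by blast
  qed
qed

text \<open>For \<open>cmod (x $ 2) powr \<epsilon> \<le> 1 / 404\<close> the outer function is at
  most the first summand of \<open>inner_part\<close>. Thus \<open>u\<close> equals
  \<open>inner_part\<close> near \<open>P\<close>, which is rational in the real coordinates with
  nonvanishing denominator.\<close>

lemma C2_on_u: "\<exists>U. open U \<and> P \<in> U \<and> U \<subseteq> shell m \<and> C2_on U u"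
proof -
  define r where "r = min \<rho> ((1 / 404) powr (1 / \<epsilon>))"
  have r: "r > 0" "r \<le> \<rho>" using \<rho> by (auto simp: r_def)
  define U where "U = shell m \<inter> {x. cmod (x $ 2) < r}"
  have op: "open U"
    unfolding U_def by (intro open_Int open_shell m open_Collect_less continuous_intros)
  have "P \<in> U"
  proof -
    have "(1/2)\<^sup>2 < (1/2 + \<delta>)\<^sup>2" using \<delta> by (intro power_strict_mono) auto
    then have "1 / 4 < (1/2 + \<delta>)\<^sup>2" by (simp add: power_divide)
    moreover have "(1/2 + \<delta>)\<^sup>2 < 1\<^sup>2" using \<delta> by (intro power_strict_mono) auto
    moreover have "cmod (of_real (1/2 + \<delta>)) = 1/2 + \<delta>" using \<delta> by (simp only: norm_of_real)
    ultimately show ?thesis using m r by (simp add: U_def P_def shell_def del: of_real_add)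
  qed
  have eq: "u x = inner_part x" if "x \<in> U" for x
  proof -
    have x: "x \<in> shell m" "cmod (x $ 2) < r" using that by (auto simp: U_def)
    have "cmod (x $ 2) powr \<epsilon> \<le> ((1 / 404) powr (1 / \<epsilon>)) powr \<epsilon>"
      using x \<epsilon> by (intro powr_mono2) (auto simp: r_def)
    also have "\<dots> = 1 / 404" using \<epsilon> by (simp add: powr_powr)
    finally have "outer x \<le> (cmod (x $ 2))\<^sup>2 * (1 / 404)"
      unfolding outer_eq by (intro mult_left_mono) auto
    also have "\<dots> \<le> inner_part x" by (simp add: inner_part_def)
    finally show ?thesis using x r by (simp add: u_def)
  qed
  let ?n = "\<lambda>x :: complex ^ 2. (cmod (x $ 1 - of_real (1/2 - 3 * \<delta>)))\<^sup>2"
  \<comment> \<open>\<open>inner_part\<close> is rewritten with \<open>- 0\<close>,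
    \<open>inverse\<close> and a constant factor to fit the closure lemmas.\<close>
  have "C2_on U (\<lambda>x. ((cmod (x $ 2 - 0))\<^sup>2 + \<rho>\<^sup>2 * ((cmod (x $ 1 - of_real (1/2 + \<delta>)))\<^sup>2 * inverse (?n x))) * (1 / 404))"
  proof (intro C2_on_mult C2_on_add C2_on_const C2_on_norm_sq_component C2_on_inverse)
    show "?n x \<noteq> 0" if "x \<in> U" for x
      using pole_dist[of x] that r \<delta> by (auto simp: U_def)
  qed
  then have "C2_on U u"
    by (rule C2_on_cong[OF _ op])
      (simp only: eq inner_part_def h_def divide_inverse norm_mult norm_inverse power_mult_distrib
        power_inverse diff_zero mult_1_left)
  then show ?thesis using op \<open>P \<in> U\<close> by (auto simp: U_def)
qed

lemma u_P: "u P = 0"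
  using \<epsilon> by (simp add: u_def outer_def inner_part_def P_def h_def)

lemma u_in_sibony_class: "u \<in> sibony_class (shell m) P"
  unfolding sibony_class_def
  using plurisubharmonic_on_log_supported[OF continuous_on_u u_range log_supported_u]
    u_P C2_on_u u_range by simp

lemma sibony_metric_lower:
  "ereal (\<rho> / (101 * \<delta>)) \<le> sibony_metric (shell m) P (axis 1 1)"
proof -
  \<comment> \<open>The factor 404 is the normalisation of \<open>inner_part\<close>, and
    \<open>25 * \<delta>\<^sup>2\<close> bounds the squared denominator of \<open>h\<close> at
    distance less than \<open>\<delta>\<close> from its zero.\<close>
  define k where "k = \<rho>\<^sup>2 / (404 * 25 * \<delta>\<^sup>2)"
  obtain U D B where U: "open U" "P \<in> U" "D P = 0"
    and D: "\<And>x. x \<in> U \<Longrightarrow> (u has_derivative blinfun_apply (D x)) (at x)"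
    and B: "(D has_derivative blinfun_apply B) (at P)"
    using sibony_class_second_order[OF u_in_sibony_class] by metis
  have Q: "2 * k \<le> B (axis 1 \<tau>) (axis 1 \<tau>)" if \<tau>: "cmod \<tau> = 1" for \<tau>
  proof (rule second_derivative_lower[OF U(1,2) D B U(3) \<delta>(1)])
    fix s :: real assume s: "0 < s" "s < \<delta>"
    let ?x = "P + s *\<^sub>R axis 1 \<tau>"
    have x: "?x $ 2 = 0" "?x $ 1 - of_real (1/2 + \<delta>) = of_real s * \<tau>"
      "?x $ 1 - of_real (1/2 - 3 * \<delta>) = of_real (4 * \<delta>) + of_real s * \<tau>"
      unfolding vector_add_component vector_scaleR_component
      by (simp_all add: P_def axis_def scaleR_conv_of_real)
    let ?n = "cmod (of_real (4 * \<delta>) + of_real s * \<tau>)"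
    have st: "cmod (of_real s * \<tau>) = s" using s \<tau> by (simp add: norm_mult)
    have f4: "cmod (of_real (4 * \<delta>)) = 4 * \<delta>" using \<delta> by (simp only: norm_of_real)
    have n: "?n \<le> 5 * \<delta>" "?n > 0"
      using norm_triangle_ineq[of "of_real (4 * \<delta>)" "of_real s * \<tau>"]
        norm_diff_ineq[of "of_real (4 * \<delta>)" "of_real s * \<tau>"] s unfolding st f4 by linarith+
    have "k * s\<^sup>2 = \<rho>\<^sup>2 * (s\<^sup>2 / (5 * \<delta>)\<^sup>2) / 404" by (simp add: k_def power2_eq_square)
    also have "\<dots> \<le> \<rho>\<^sup>2 * (s\<^sup>2 / ?n\<^sup>2) / 404"
      using n by (intro divide_right_mono mult_left_mono divide_left_mono power_mono mult_pos_pos) auto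
    also have "\<dots> = inner_part ?x"
      unfolding inner_part_def h_def x norm_divide st power_divide by simp
    also have "\<dots> \<le> u ?x" using \<rho>(1) x(1) by (simp add: u_def)
    finally show "u P + k * s\<^sup>2 \<le> u ?x" by (simp add: u_P)
  qed
  have "k \<le> Re (levi_form u P (axis 1 1))"
    using Re_levi_form_axis[OF U(1,2) D B] Q[of 1] Q[of \<i>] by simp
  \<comment> \<open>The constant 101 is chosen because \<open>404 * 25 = 10100\<close> is at most
    \<open>101\<^sup>2 = 10201\<close>.\<close>
  moreover have "(\<rho> / (101 * \<delta>))\<^sup>2 \<le> k"
    unfolding k_def power_divide using \<delta> by (intro divide_left_mono) (auto simp: power2_eq_square)
  ultimately have "\<rho> / (101 * \<delta>) \<le> sqrt (Re (levi_form u P (axis 1 1)))"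
    by (intro real_le_rsqrt) simp
  then show ?thesis
    unfolding sibony_metric_def using u_in_sibony_class by (intro SUP_upper2) auto
qed

end

theorem theorem2:
  fixes m :: real
  assumes "m \<ge> 2"
  shows "\<exists>C\<ge>1. \<exists>\<delta>\<^sub>0>0. \<forall>\<delta>::real. 0 < \<delta> \<and> \<delta> < \<delta>\<^sub>0 \<longrightarrow>
           ereal (inverse C * (1 / \<delta> powr (1 - 1 / m)))
             \<le> sibony_metric (shell m) (vector [of_real (1/2 + \<delta>), 0]) (vector [1, 0]) \<and>
           sibony_metric (shell m) (vector [of_real (1/2 + \<delta>), 0]) (vector [1, 0])
             \<le> ereal (C * (1 / \<delta> powr (1 - 1 / m)))"
proof -
  have ax: "vector [1, 0] = (axis 1 1 :: complex ^ 2)"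
    by (simp add: vec_eq_iff forall_2 axis_def)
  \<comment> \<open>The lower bound dictates 101; the upper bound holds with 2, from
    \<open>1 / R\<close>.\<close>
  have "ereal (inverse 101 * (1 / \<delta> powr (1 - 1 / m)))
             \<le> sibony_metric (shell m) (vector [of_real (1/2 + \<delta>), 0]) (vector [1, 0]) \<and>
           sibony_metric (shell m) (vector [of_real (1/2 + \<delta>), 0]) (vector [1, 0])
             \<le> ereal (101 * (1 / \<delta> powr (1 - 1 / m)))"
    if \<delta>: "0 < \<delta>" "\<delta> < 1 / 16" for \<delta> :: real
  proof
    interpret competitor m \<delta> by unfold_locales (use assms \<delta> in auto)
    have "\<rho> / (101 * \<delta>) = inverse 101 * (1 / \<delta> powr (1 - 1 / m))"
      using \<delta> by (simp add: \<rho>_def powr_diff)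
    then show "ereal (inverse 101 * (1 / \<delta> powr (1 - 1 / m)))
        \<le> sibony_metric (shell m) (vector [of_real (1/2 + \<delta>), 0]) (vector [1, 0])"
      using sibony_metric_lower unfolding ax P_def by simp
    let ?R = "\<delta> powr (1 - 1 / m) / 2"
    have "sibony_metric (shell m) (vector [of_real (1/2 + \<delta>), 0]) (axis 1 1) \<le> ereal (1 / ?R)"
    proof (rule sibony_metric_upper)
      show "?R > 0" using \<delta> by simp
      show "vector [of_real (1/2 + \<delta>), 0] + t *s (axis 1 (of_real ?R) + axis 2 (of_real (\<sigma> * (1/2)))) \<in> shell m"
        if "t \<in> cball 0 1" "\<bar>\<sigma>\<bar> = 1" for t \<sigma>
        using that by (intro shell_disc[OF assms \<delta> refl]) auto
    qed
    also have "\<dots> \<le> ereal (101 * (1 / \<delta> powr (1 - 1 / m)))"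
      using \<delta> by (simp add: divide_right_mono)
    finally show "sibony_metric (shell m) (vector [of_real (1/2 + \<delta>), 0]) (vector [1, 0])
        \<le> ereal (101 * (1 / \<delta> powr (1 - 1 / m)))"
      unfolding ax .
  qed
  then show ?thesis
    by (intro exI[of _ 101] conjI exI[of _ "1/16"]) simp_all
qed

end
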